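(* Let $d$ be a positive integer and $\delta > 0$. Then for all sufficiently large $n$, $M_{2,d}(n) < \delta n^2$.
   Context: For a finite set $S \subset \mathbb{R}^d$, the Vietoris–Rips complex $R(S)$ is the simplicial complex on vertex set $S$ whose faces are all subsets of $S$ of (Euclidean) diameter at most $1$. For a fixed field $\mathbf{k}$, $\tilde{\beta}_p(\Gamma)=\dim_{\mathbf{k}}\tilde{H}_p(\Gamma;\mathbf{k})$ denotes the $p$-th reduced Betti number. Define $M_{p,d}(n) := \max\{\tilde{\beta}_p(R(S)) : S \subset \mathbb{R}^d,\ |S| \leq n\}$. *)

theory Defs
  imports
    "HOL-Analysis.Analysis"
    "HOL-Combinatorics.Permutations"
    "HOL-Algebra.AbelCoset"
    "Jordan_Normal_Form.VS_Connect"
begin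

text \<open>
  Oriented simplicial chains with coefficients in a field. An oriented simplex is represented by
  an ordering of its vertices, and a chain is a finitely supported function on the orderings of the
  simplices that changes sign under odd permutations of the vertices. The
  index \<open>m\<close> counts vertices: \<open>oriented_chains K m\<close> is the chain space in dimension \<open>m - 1\<close>.
  For \<open>m = 0\<close> it is spanned by the empty face of \<open>K\<close>, so the chain complex is the augmented
  one, which computes reduced homology.
\<close>

definition oriented_chains :: "'a set set \<Rightarrow> nat \<Rightarrow> ('k::field, 'a list \<Rightarrow> 'k) module" where
  "oriented_chains K m =
     \<lparr>carrier = {c. finite {xs. c xs \<noteq> 0} \<and>
                    (\<forall>xs. c xs \<noteq> 0 \<longrightarrow> length xs = m \<and> distinct xs \<and> set xs \<in> K) \<and>
                    (\<forall>xs \<pi>. \<pi> permutes {..<length xs} \<longrightarrow>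
                       c (permute_list \<pi> xs) = of_int (sign \<pi>) * c xs)},
      mult = undefined, one = undefined,
      zero = (\<lambda>xs. 0), add = (\<lambda>c c' xs. c xs + c' xs),
      smult = (\<lambda>a c xs. a * c xs)\<rparr>"

text \<open>
  The usual boundary map, determined by
  \<open>\<partial>[v\<^sub>0, \<dots>, v\<^sub>p] = (\<Sum>i\<le>p. (-1)^i [v\<^sub>0, \<dots>, v\<^sub>i\<^sub>-\<^sub>1, v\<^sub>i\<^sub>+\<^sub>1, \<dots>, v\<^sub>p])\<close>, expressed on coefficients.
  As \<open>[v\<^sub>0, \<dots>, v\<^sub>p] = (-1)^i [v\<^sub>i, v\<^sub>0, \<dots>, v\<^sub>i\<^sub>-\<^sub>1, v\<^sub>i\<^sub>+\<^sub>1, \<dots>, v\<^sub>p]\<close>, the coefficient of an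
  oriented simplex \<open>ys\<close> in \<open>\<partial>c\<close> is the sum over all vertices \<open>v\<close> of the coefficient of
  \<open>v # ys\<close> in \<open>c\<close>.
\<close>

definition boundary :: "('a list \<Rightarrow> 'k::field) \<Rightarrow> 'a list \<Rightarrow> 'k" where
  "boundary c ys = (\<Sum>v | c (v # ys) \<noteq> 0. c (v # ys))"

definition cycles :: "'a set set \<Rightarrow> nat \<Rightarrow> ('a list \<Rightarrow> 'k::field) set" where
  "cycles K m = {c \<in> carrier (oriented_chains K m). boundary c = (\<lambda>ys. 0)}"

definition boundaries :: "'a set set \<Rightarrow> nat \<Rightarrow> ('a list \<Rightarrow> 'k::field) set" where
  "boundaries K m = boundary ` carrier (oriented_chains K (Suc m))"

definition quotient_module ::
  "('k, 'v, 'm) module_scheme \<Rightarrow> 'v set \<Rightarrow> ('k, 'v set) module" where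
  "quotient_module V W =
     \<lparr>carrier = a_rcosets\<^bsub>V\<^esub> W,
      mult = undefined, one = undefined,
      zero = W, add = set_add V,
      smult = (\<lambda>a X. \<Union>x\<in>X. W +>\<^bsub>V\<^esub> (a \<odot>\<^bsub>V\<^esub> x))\<rparr>"

definition reduced_homology ::
  "nat \<Rightarrow> 'a set set \<Rightarrow> ('k::field, ('a list \<Rightarrow> 'k) set) module" where
  "reduced_homology p K =
     quotient_module ((oriented_chains K (Suc p))\<lparr>carrier := cycles K (Suc p)\<rparr>)
       (boundaries K (Suc p))"

definition reduced_betti :: "'k::field itself \<Rightarrow> nat \<Rightarrow> 'a set set \<Rightarrow> nat" where
  "reduced_betti _ p K =
     vectorspace.dim class_ring (reduced_homology p K :: ('k, ('a list \<Rightarrow> 'k) set) module)"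

definition vietoris_rips :: "'a::metric_space set \<Rightarrow> 'a set set" where
  "vietoris_rips S = {\<sigma>. \<sigma> \<subseteq> S \<and> diameter \<sigma> \<le> 1}"

text \<open>
  The maximum \<open>M\<^sub>p\<^sub>,\<^sub>d(n)\<close> over the field \<open>'k\<close>, with \<open>d = CARD('d)\<close>. The set is finite: a
  complex on at most \<open>n\<close> vertices has \<open>p\<close>-th Betti number at most \<open>n choose (p + 1)\<close>.
\<close>

definition max_betti_rips ::
  "'k::field itself \<Rightarrow> 'd::finite itself \<Rightarrow> nat \<Rightarrow> nat \<Rightarrow> nat" where
  "max_betti_rips k _ p n =
     Max {reduced_betti k p (vietoris_rips S) | S :: (real ^ 'd) set. finite S \<and> card S \<le> n}"

end

theory Submission
  imports Defs "HOL-Library.Function_Algebras" "HOL-Real_Asymp.Real_Asymp"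
begin

text \<open>
  Adding the points one at a time, each new point \<open>v\<close> raises the second Betti number by at most the
  first Betti number of its link, and building up that link point by point bounds the latter by the
  number of points \<open>w\<close> for which the current common neighbourhood of \<open>v\<close> and \<open>w\<close> is disconnected,
  times a constant depending on the dimension. It remains to see that only \<open>o(n\<^sup>2)\<close> pairs are bad.

  Cut space into cells of diameter at most 1, and build up the link of \<open>v\<close> by starting with the points
  in the cell of \<open>v\<close>. Unit balls have bounded VC dimension, so for every \<open>\<epsilon>\<close> the points fall into boundedly
  many classes within which neighbourhoods differ in at most \<open>\<epsilon> n\<close> points. Let \<open>u\<close> be an earlier point
  with the same cell and class as \<open>v\<close>. If \<open>(v, w)\<close> is bad and \<open>w\<close> is one of the all but \<open>\<epsilon> n\<close>
  neighbours of \<open>v\<close> that are adjacent to \<open>u\<close>, then \<open>u\<close> is a common neighbour, and some common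
  neighbour \<open>x(w)\<close> is not connected to \<open>u\<close>. It is one of the at most \<open>\<epsilon> n\<close> neighbours of \<open>v\<close> not
  adjacent to \<open>u\<close>, and \<open>x\<close> is injective on each cell, because an earlier \<open>w'\<close> in the cell of \<open>w\<close> with
  \<open>x(w') = x(w)\<close> would connect \<open>u\<close> to \<open>x(w)\<close>. Hence all \<open>v\<close> but the first of each cell and class lie
  in \<open>O(\<epsilon> n)\<close> bad pairs.
\<close>

section \<open>Shattering and separated families\<close>

definition shatters :: "'a set set \<Rightarrow> 'a set \<Rightarrow> bool" where
  "shatters F Y \<longleftrightarrow> (\<forall>Z\<subseteq>Y. \<exists>A\<in>F. A \<inter> Y = Z)"

text \<open>Pajor's form of the Sauer-Shelah lemma. Split \<open>F\<close> at \<open>y\<close> into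
  the members avoiding \<open>y\<close> and those containing it, the latter with \<open>y\<close>
  removed. A set shattered by either half is shattered by \<open>F\<close>; one shattered by both
  stays shattered when \<open>y\<close> is added, which pays for counting it twice.\<close>

lemma card_le_card_shattered:
  assumes "finite X" "F \<subseteq> Pow X"
  shows "card F \<le> card {Z. Z \<subseteq> X \<and> shatters F Z}"
  using assms
proof (induction X arbitrary: F rule: finite_induct)
  case empty
  then have "F = {} \<or> F = {{}}" by auto
  then show ?case
  proof
    assume F: "F = {{}}"
    then have "{Z. Z \<subseteq> {} \<and> shatters F Z} = {{}}" by (auto simp: shatters_def)
    then show ?thesis using F by simp
  qed simp
next
  case (insert y X)
  define F0 where "F0 = {A \<in> F. y \<notin> A}"
  define F1 where "F1 = (\<lambda>A. A - {y}) ` {A \<in> F. y \<in> A}"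
  let ?sh = "\<lambda>F X. {Z. Z \<subseteq> X \<and> shatters F Z}"
  have F0: "F0 \<subseteq> Pow X" and F1: "F1 \<subseteq> Pow X"
    using insert.prems unfolding F0_def F1_def by auto
  have finF: "finite F" using insert.prems insert.hyps(1) by (simp add: finite_subset)
  have "card F = card F0 + card {A \<in> F. y \<in> A}"
    unfolding F0_def using finF
    by (subst card_Un_disjoint[symmetric]) (auto intro: arg_cong[where f = card])
  moreover have "card {A \<in> F. y \<in> A} = card F1"
    unfolding F1_def by (rule card_image[symmetric]) (auto simp: inj_on_def)
  ultimately have "card F = card F0 + card F1" by simp
  also have "\<dots> \<le> card (?sh F0 X) + card (?sh F1 X)"
    using insert.IH[OF F0] insert.IH[OF F1] by simp
  also have "\<dots> = card (?sh F0 X \<union> ?sh F1 X) + card (?sh F0 X \<inter> ?sh F1 X)"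
    using insert.hyps(1) by (intro card_Un_Int) auto
  also have "card (?sh F0 X \<inter> ?sh F1 X) = card (Set.insert y ` (?sh F0 X \<inter> ?sh F1 X))"
    using insert.hyps(2) by (intro card_image[symmetric] inj_onI) (metis (no_types, lifting) IntE insert_ident mem_Collect_eq subsetD)
  also have "card (?sh F0 X \<union> ?sh F1 X) + \<dots>
      = card ((?sh F0 X \<union> ?sh F1 X) \<union> Set.insert y ` (?sh F0 X \<inter> ?sh F1 X))"
    using insert.hyps by (intro card_Un_disjoint[symmetric]) auto
  also have "\<dots> \<le> card (?sh F (Set.insert y X))"
  proof (intro card_mono)
    show "finite (?sh F (Set.insert y X))" using insert.hyps(1) by simp
    have a: "shatters F Z" if h: "shatters F0 Z" for Z
      using h unfolding shatters_def F0_def by blast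
    have b: "shatters F Z" if h: "shatters F1 Z" "Z \<subseteq> X" for Z
      unfolding shatters_def
    proof (intro allI impI)
      fix W assume "W \<subseteq> Z"
      then obtain A where A: "A \<in> F1" "A \<inter> Z = W" using h(1) unfolding shatters_def by blast
      then obtain A' where "A' \<in> F" "A = A' - {y}" unfolding F1_def by auto
      moreover have "y \<notin> Z" using h(2) insert.hyps(2) by auto
      ultimately show "\<exists>A\<in>F. A \<inter> Z = W" using A(2) by (intro bexI[of _ A']) auto
    qed
    have c: "shatters F (Set.insert y Z)" if h: "shatters F0 Z" "shatters F1 Z" "Z \<subseteq> X" for Z
      unfolding shatters_def
    proof (intro allI impI)
      fix W assume W: "W \<subseteq> Set.insert y Z"
      then have W': "W - {y} \<subseteq> Z" by auto
      have yZ: "y \<notin> Z" using h(3) insert.hyps(2) by auto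
      show "\<exists>A\<in>F. A \<inter> Set.insert y Z = W"
      proof (cases "y \<in> W")
        case True
        obtain A where A: "A \<in> F1" "A \<inter> Z = W - {y}"
          using h(2) W' unfolding shatters_def by blast
        then obtain A' where "A' \<in> F" "A = A' - {y}" "y \<in> A'" unfolding F1_def by auto
        then show ?thesis using A(2) True W yZ by (intro bexI[of _ A']) auto
      next
        case False
        obtain A where A: "A \<in> F0" "A \<inter> Z = W - {y}"
          using h(1) W' unfolding shatters_def by blast
        then show ?thesis using False unfolding F0_def by (intro bexI[of _ A]) auto
      qed
    qed
    show "?sh F0 X \<union> ?sh F1 X \<union> Set.insert y ` (?sh F0 X \<inter> ?sh F1 X) \<subseteq> ?sh F (Set.insert y X)"
      using a b c by auto
  qed
  finally show ?case .
qed

text \<open>Lists of length \<open>D\<close> over \<open>Y\<close>, padded with \<open>None\<close>,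
  reach every such subset. The count is crude, but only polynomial growth in \<open>m\<close>
  matters later.\<close>

lemma card_small_subsets_le:
  assumes "finite Y" "card Y \<le> m"
  shows "card {Z. Z \<subseteq> Y \<and> card Z \<le> D} \<le> (m + 1) ^ D"
proof -
  let ?L = "{xs. set xs \<subseteq> Set.insert None (Some ` Y) \<and> length xs = D}"
  have "{Z. Z \<subseteq> Y \<and> card Z \<le> D} \<subseteq> (\<lambda>xs. {y. Some y \<in> set xs}) ` ?L"
  proof
    fix Z assume Z: "Z \<in> {Z. Z \<subseteq> Y \<and> card Z \<le> D}"
    then obtain zs where zs: "set zs = Z" "distinct zs"
      using assms(1) finite_distinct_list finite_subset by blast
    define xs where "xs = map Some zs @ replicate (D - length zs) None"
    have "length zs \<le> D" using Z zs distinct_card by fastforce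
    then have "xs \<in> ?L" using Z zs unfolding xs_def by auto
    moreover have "{y. Some y \<in> set xs} = Z" using zs unfolding xs_def by auto
    ultimately show "Z \<in> (\<lambda>xs. {y. Some y \<in> set xs}) ` ?L" by blast
  qed
  then have "card {Z. Z \<subseteq> Y \<and> card Z \<le> D} \<le> card ?L"
    using assms(1) by (intro surj_card_le finite_lists_length_eq) auto
  also have "\<dots> = card (Set.insert None (Some ` Y)) ^ D"
    using assms(1) by (intro card_lists_length_eq) auto
  also have "card (Set.insert None (Some ` Y)) = card Y + 1"
    using assms(1) by (simp add: card_image)
  also have "(card Y + 1) ^ D \<le> (m + 1) ^ D" using assms(2) by (intro power_mono) auto
  finally show ?thesis .
qed

text \<open>Averaging over the ground set: each new sample point separates an \<open>\<eta>\<close>-fraction of the pairs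
  that the previous ones fail to separate.\<close>

lemma exists_separating_sample:
  fixes \<eta> :: real
  assumes fin: "finite S" "finite F" and ne: "S \<noteq> {}" and eta: "\<eta> \<le> 1"
    and sep: "\<And>A B. A \<in> F \<Longrightarrow> B \<in> F \<Longrightarrow> A \<noteq> B \<Longrightarrow> \<eta> * card S \<le> card (S \<inter> sym_diff A B)"
  shows "\<exists>Y\<subseteq>S. card Y \<le> m \<and>
    card {p \<in> F \<times> F. fst p \<noteq> snd p \<and> fst p \<inter> Y = snd p \<inter> Y} \<le> (1 - \<eta>) ^ m * (card F)\<^sup>2"
proof (induction m)
  case 0
  have "card {p \<in> F \<times> F. fst p \<noteq> snd p \<and> fst p \<inter> {} = snd p \<inter> {}} \<le> card (F \<times> F)"
    using fin by (intro card_mono) auto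
  then have "real (card {p \<in> F \<times> F. fst p \<noteq> snd p \<and> fst p \<inter> {} = snd p \<inter> {}}) \<le> (card F)\<^sup>2"
    by (simp add: card_cartesian_product power2_eq_square flip: of_nat_mult)
  then show ?case by (intro exI[of _ "{}"]) auto
next
  case (Suc m)
  then obtain Y where Y: "Y \<subseteq> S" "card Y \<le> m"
    "card {p \<in> F \<times> F. fst p \<noteq> snd p \<and> fst p \<inter> Y = snd p \<inter> Y} \<le> (1 - \<eta>) ^ m * (card F)\<^sup>2" by blast
  define U where "U = {p \<in> F \<times> F. fst p \<noteq> snd p \<and> fst p \<inter> Y = snd p \<inter> Y}"
  have finU: "finite U" unfolding U_def using fin by simp
  \<comment> \<open>Double counting: every pair in \<open>U\<close> is separated by at least
    \<open>\<eta> * card S\<close> points, so some point separates at least the average number of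
    pairs.\<close>
  have "\<exists>s\<in>S. \<eta> * card U \<le> card {p \<in> U. s \<in> sym_diff (fst p) (snd p)}"
  proof (rule ccontr)
    assume "\<not> ?thesis"
    then have *: "\<And>s. s \<in> S \<Longrightarrow> card {p \<in> U. s \<in> sym_diff (fst p) (snd p)} < \<eta> * card U"
      by force
    have "\<eta> * card S * card U = (\<Sum>p\<in>U. \<eta> * card S)" by simp
    also have "\<dots> \<le> (\<Sum>p\<in>U. real (card (S \<inter> sym_diff (fst p) (snd p))))"
      by (rule sum_mono, rule sep) (simp_all add: U_def mem_Times_iff)
    also have "\<dots> = (\<Sum>p\<in>U. \<Sum>s\<in>S. if s \<in> sym_diff (fst p) (snd p) then 1 else 0)"
      using fin(1) by (intro sum.cong refl) (auto simp: sum.If_cases intro!: arg_cong[where f = card])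
    also have "\<dots> = (\<Sum>s\<in>S. \<Sum>p\<in>U. if s \<in> sym_diff (fst p) (snd p) then 1 else 0)"
      by (rule sum.swap)
    also have "\<dots> = (\<Sum>s\<in>S. real (card {p \<in> U. s \<in> sym_diff (fst p) (snd p)}))"
      using finU by (intro sum.cong refl) (simp add: sum.If_cases Int_def)
    also have "\<dots> < (\<Sum>s\<in>S. \<eta> * card U)"
      using fin(1) ne by (intro sum_strict_mono *) auto
    finally show False by (simp add: mult_ac)
  qed
  then obtain s where s: "s \<in> S" "\<eta> * card U \<le> card {p \<in> U. s \<in> sym_diff (fst p) (snd p)}" by blast
  let ?U' = "{p \<in> F \<times> F. fst p \<noteq> snd p \<and> fst p \<inter> Set.insert s Y = snd p \<inter> Set.insert s Y}"
  have U'sub: "?U' \<subseteq> U - {p \<in> U. s \<in> sym_diff (fst p) (snd p)}" unfolding U_def by blast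
  then have "card ?U' \<le> card (U - {p \<in> U. s \<in> sym_diff (fst p) (snd p)})"
    using finU by (intro card_mono) auto
  also have "\<dots> = card U - card {p \<in> U. s \<in> sym_diff (fst p) (snd p)}"
    using finU by (intro card_Diff_subset) auto
  finally have "real (card ?U') \<le> card U - real (card {p \<in> U. s \<in> sym_diff (fst p) (snd p)})"
    using card_mono[OF finU, of "{p \<in> U. s \<in> sym_diff (fst p) (snd p)}"] by force
  also have "\<dots> \<le> (1 - \<eta>) * card U" using s(2) by (simp add: algebra_simps)
  also have "\<dots> \<le> (1 - \<eta>) ^ Suc m * (card F)\<^sup>2"
  proof -
    have "(1 - \<eta>) * card U \<le> (1 - \<eta>) * ((1 - \<eta>) ^ m * (card F)\<^sup>2)"
      using Y(3) eta unfolding U_def by (intro mult_left_mono) auto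
    then show ?thesis by (simp add: mult_ac)
  qed
  finally show ?case
    using Y(1,2) s(1) fin(1) by (intro exI[of _ "Set.insert s Y"]) (auto simp: card_insert_if finite_subset)
qed

section \<open>Neighbourhoods of points under unit distance\<close>

text \<open>A weak form of Haussler's packing lemma. If \<open>F\<close> is too large, a sample of
  at most \<open>m\<close> points separates all members of a large subfamily \<open>G\<close>, so
  their traces on the sample are distinct; but a family that shatters only sets of size at most
  \<open>D\<close> has at most \<open>(m + 1) ^ D\<close> traces there. The point is that
  \<open>K\<close> does not depend on \<open>S\<close>.\<close>

lemma separated_family_bounded:
  fixes \<eta> :: real
  assumes "0 < \<eta>"
  obtains K :: nat where
    "\<And>(S::'a set) F. \<lbrakk>finite S; S \<noteq> {}; F \<subseteq> Pow S; \<And>Y. shatters F Y \<Longrightarrow> card Y \<le> D;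
       \<And>A B. \<lbrakk>A \<in> F; B \<in> F; A \<noteq> B\<rbrakk> \<Longrightarrow> \<eta> * card S \<le> card (S \<inter> sym_diff A B)\<rbrakk>
     \<Longrightarrow> card F \<le> K"
proof -
  \<comment> \<open>Truncation keeps \<open>1 - \<epsilon>\<close> positive, so that its logarithm
    gives a rate of decay.\<close>
  define \<epsilon> where "\<epsilon> = min \<eta> (1/2)"
  have eps: "0 < \<epsilon>" "\<epsilon> < 1" "\<epsilon> \<le> \<eta>" using assms unfolding \<epsilon>_def by auto
  define a where "a = - ln (1 - \<epsilon>)"
  have a: "a > 0" using eps unfolding a_def by simp
  have lim: "((\<lambda>m::nat. exp (- a * real m) * ((real m + 1) powr p + 1)\<^sup>2) \<longlongrightarrow> 0) at_top"
    if "p > 0" for p :: real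
    using a that by real_asymp
  \<comment> \<open>The proportion of unseparated pairs decays exponentially in \<open>m\<close>,
    the number of pairs grows polynomially; \<open>m\<close> is chosen so that their product is
    below 1.\<close>
  have "eventually (\<lambda>m. exp (- a * real m) * ((real m + 1) powr real (Suc D) + 1)\<^sup>2 < 1) at_top"
    by (rule order_tendstoD(2)[OF lim]) auto
  then obtain m :: nat where
    m: "exp (- a * real m) * ((real m + 1) powr real (Suc D) + 1)\<^sup>2 < 1"
    by (auto simp: eventually_at_top_linorder)
  have "exp (- a * real m) = (1 - \<epsilon>) ^ m"
    using eps by (simp add: a_def exp_of_nat2_mult)
  moreover have "(real m + 1) powr real (Suc D) = (real m + 1) ^ Suc D"
    by (rule powr_realpow) simp
  ultimately have m: "(1 - \<epsilon>) ^ m * ((real m + 1) ^ Suc D + 1)\<^sup>2 < 1"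
    using m by metis
  have "card F \<le> (m + 1) ^ Suc D"
    if S: "finite S" "S \<noteq> {}" and F: "F \<subseteq> Pow S" and sh: "\<And>Y. shatters F Y \<Longrightarrow> card Y \<le> D"
      and sep: "\<And>A B. \<lbrakk>A \<in> F; B \<in> F; A \<noteq> B\<rbrakk> \<Longrightarrow> \<eta> * card S \<le> card (S \<inter> sym_diff A B)"
    for S :: "'a set" and F
  proof (rule ccontr)
    assume "\<not> card F \<le> (m + 1) ^ Suc D"
    then have "(m + 1) ^ Suc D + 1 \<le> card F" by simp
    \<comment> \<open>The choice of \<open>m\<close> is tuned to families of exactly this size,
      hence the passage to a subfamily.\<close>
    then obtain G where G: "G \<subseteq> F" "card G = (m + 1) ^ Suc D + 1" "finite G"
      using obtain_subset_with_card_n by metis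
    have "\<epsilon> * card S \<le> card (S \<inter> sym_diff A B)" if "A \<in> G" "B \<in> G" "A \<noteq> B" for A B
      using sep[of A B] that G(1) mult_right_mono[OF eps(3), of "card S"] by fastforce
    then obtain Y where Y: "Y \<subseteq> S" "card Y \<le> m"
      "card {p \<in> G \<times> G. fst p \<noteq> snd p \<and> fst p \<inter> Y = snd p \<inter> Y} \<le> (1 - \<epsilon>) ^ m * (card G)\<^sup>2"
      using exists_separating_sample[of S G \<epsilon> m] S G(3) eps by auto
    let ?U = "{p \<in> G \<times> G. fst p \<noteq> snd p \<and> fst p \<inter> Y = snd p \<inter> Y}"
    have "real (card G) = (real m + 1) ^ Suc D + 1" unfolding G(2) by (simp add: algebra_simps)
    \<comment> \<open>Fewer than one unseparated pair means none.\<close>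
    then have "real (card ?U) < 1" using Y(3) m by simp
    then have "?U = {}" using G(3) by simp
    then have inj: "inj_on (\<lambda>A. A \<inter> Y) G" by (auto simp: inj_on_def)
    have finY: "finite Y" using Y(1) S(1) finite_subset by blast
    have "card G = card ((\<lambda>A. A \<inter> Y) ` G)" using inj by (simp add: card_image)
    also have "\<dots> \<le> card {Z. Z \<subseteq> Y \<and> shatters ((\<lambda>A. A \<inter> Y) ` G) Z}"
      by (rule card_le_card_shattered[OF finY]) auto
    also have "\<dots> \<le> card {Z. Z \<subseteq> Y \<and> card Z \<le> D}"
    proof (rule card_mono)
      have "shatters F Z" if "shatters ((\<lambda>A. A \<inter> Y) ` G) Z" "Z \<subseteq> Y" for Z
        unfolding shatters_def
      proof (intro allI impI)
        fix W assume "W \<subseteq> Z"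
        then have "\<exists>A\<in>(\<lambda>A. A \<inter> Y) ` G. A \<inter> Z = W"
          using that(1) unfolding shatters_def by blast
        then obtain A where "A \<in> G" "A \<inter> Y \<inter> Z = W" by blast
        then show "\<exists>A\<in>F. A \<inter> Z = W" using G(1) that(2) by (intro bexI[of _ A]) auto
      qed
      then show "{Z. Z \<subseteq> Y \<and> shatters ((\<lambda>A. A \<inter> Y) ` G) Z} \<subseteq> {Z. Z \<subseteq> Y \<and> card Z \<le> D}"
        using sh by blast
    qed (use finY in simp)
    also have "\<dots> \<le> (m + 1) ^ D" by (rule card_small_subsets_le[OF finY Y(2)])
    also have "\<dots> \<le> (m + 1) ^ Suc D" by simp
    finally show False using G(2) by simp
  qed
  then show ?thesis by (rule that)
qed

text \<open>The two parts of a Radon partition of \<open>Y\<close> cannot both be cut out by unit balls, since the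
  radical hyperplane of the two balls would separate their convex hulls.\<close>

lemma card_shattered_by_unit_balls:
  fixes S :: "'a::euclidean_space set"
  assumes F: "F \<subseteq> range (\<lambda>v. {x \<in> S. dist v x \<le> 1})" and sh: "shatters F Y"
  shows "card Y \<le> DIM('a) + 1"
proof (rule ccontr)
  assume "\<not> ?thesis"
  then have card: "card Y \<ge> DIM('a) + 2" by simp
  have fin: "finite Y" using card by (metis card.infinite not_numeral_le_zero add_is_0 le_zero_eq zero_neq_numeral)
  have "affine_dependent Y" using fin card by (intro affine_dependent_biggerset) auto
  then obtain m p where mp: "m \<inter> p = {}" "m \<union> p = Y" "convex hull m \<inter> convex hull p \<noteq> {}"
    using Radon_partition[OF fin] by blast
  have "Y \<subseteq> S" using sh F unfolding shatters_def by blast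
  obtain A where A: "A \<in> F" "A \<inter> Y = m" using sh mp unfolding shatters_def by blast
  obtain B where B: "B \<in> F" "B \<inter> Y = p" using sh mp unfolding shatters_def by blast
  obtain a where a: "A = {x \<in> S. dist a x \<le> 1}" using A F by blast
  obtain b where b: "B = {x \<in> S. dist b x \<le> 1}" using B F by blast
  define r where "r = (norm b)\<^sup>2 - (norm a)\<^sup>2"
  have lt: "(2 *\<^sub>R (b - a)) \<bullet> x < r \<longleftrightarrow> dist a x < dist b x"
    and gt: "(2 *\<^sub>R (b - a)) \<bullet> x > r \<longleftrightarrow> dist b x < dist a x" for x
  proof -
    have e: "(dist b x)\<^sup>2 - (dist a x)\<^sup>2 = r - (2 *\<^sub>R (b - a)) \<bullet> x"
      unfolding r_def dist_norm power2_norm_eq_inner by (simp add: algebra_simps inner_commute)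
    have q: "dist y x < dist z x \<longleftrightarrow> (dist y x)\<^sup>2 < (dist z x)\<^sup>2" for y z
      by (simp flip: not_le)
    show "(2 *\<^sub>R (b - a)) \<bullet> x < r \<longleftrightarrow> dist a x < dist b x"
      unfolding q using e by linarith
    show "(2 *\<^sub>R (b - a)) \<bullet> x > r \<longleftrightarrow> dist b x < dist a x"
      unfolding q using e by linarith
  qed
  have "convex hull m \<subseteq> {x. (2 *\<^sub>R (b - a)) \<bullet> x < r}"
  proof (rule hull_minimal)
    \<comment> \<open>Points of \<open>m\<close> lie in \<open>A\<close> and not in
      \<open>B\<close>: they are within distance 1 of \<open>a\<close> and farther than 1 from
      \<open>b\<close>.\<close>
    show "m \<subseteq> {x. (2 *\<^sub>R (b - a)) \<bullet> x < r}"
      using A B a b mp(1,2) \<open>Y \<subseteq> S\<close> unfolding lt by fastforce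
  qed (rule convex_halfspace_lt)
  moreover have "convex hull p \<subseteq> {x. (2 *\<^sub>R (b - a)) \<bullet> x > r}"
  proof (rule hull_minimal)
    show "p \<subseteq> {x. (2 *\<^sub>R (b - a)) \<bullet> x > r}"
      using A B a b mp(1,2) \<open>Y \<subseteq> S\<close> unfolding gt by fastforce
  qed (rule convex_halfspace_gt)
  ultimately show False using mp(3) by force
qed

text \<open>Each point is labelled by a nearby member of a maximal \<open>\<eta>/2\<close>-separated
  family of neighbourhoods. The packing bound controls the number of labels, maximality supplies a
  nearby member, and two points with equal labels are compared through it at a cost of twice
  \<open>\<eta>/2\<close>.\<close>

lemma neighbourhood_classes:
  fixes \<eta> :: real
  assumes "0 < \<eta>"
  obtains K :: nat where
    "\<And>S :: 'a::euclidean_space set. finite S \<Longrightarrow>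
       \<exists>cl :: 'a \<Rightarrow> 'a set. card (cl ` S) \<le> K \<and>
         (\<forall>u\<in>S. \<forall>v\<in>S. cl u = cl v \<longrightarrow>
            card {x \<in> S. dist u x \<le> 1 \<and> \<not> dist v x \<le> 1} \<le> \<eta> * card S)"
proof -
  obtain K :: nat where
    K: "\<And>(S::'a set) F. \<lbrakk>finite S; S \<noteq> {}; F \<subseteq> Pow S; \<And>Y. shatters F Y \<Longrightarrow> card Y \<le> DIM('a) + 1;
       \<And>A B. \<lbrakk>A \<in> F; B \<in> F; A \<noteq> B\<rbrakk> \<Longrightarrow> (\<eta>/2) * card S \<le> card (S \<inter> sym_diff A B)\<rbrakk>
     \<Longrightarrow> card F \<le> K"
    by (rule separated_family_bounded[of "\<eta>/2" "DIM('a) + 1", where 'a = 'a])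
      (use assms in simp, blast)
  have "\<exists>cl :: 'a \<Rightarrow> 'a set. card (cl ` S) \<le> K \<and>
         (\<forall>u\<in>S. \<forall>v\<in>S. cl u = cl v \<longrightarrow>
            card {x \<in> S. dist u x \<le> 1 \<and> \<not> dist v x \<le> 1} \<le> \<eta> * card S)"
    if S: "finite S" for S :: "'a set"
  proof (cases "S = {}")
    case False
    define N where "N v = {x \<in> S. dist v x \<le> 1}" for v
    define sep where "sep F \<longleftrightarrow> F \<subseteq> N ` S \<and> (\<forall>A\<in>F. \<forall>B\<in>F. A \<noteq> B \<longrightarrow>
      (\<eta>/2) * card S \<le> card (S \<inter> sym_diff A B))" for F
    have "finite {F. sep F}"
      by (rule finite_subset[of _ "Pow (N ` S)"]) (use S in \<open>auto simp: sep_def\<close>)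
    moreover have "sep {}" by (simp add: sep_def)
    ultimately obtain F where F: "sep F" and max: "\<And>G. sep G \<Longrightarrow> F \<subseteq> G \<Longrightarrow> G = F"
      using finite_has_maximal[of "{F. sep F}"] by (metis empty_iff mem_Collect_eq)
    have "card F \<le> K"
    proof (rule K[OF S False])
      show "F \<subseteq> Pow S" using F by (auto simp: sep_def N_def)
      show "card Y \<le> DIM('a) + 1" if "shatters F Y" for Y
        by (rule card_shattered_by_unit_balls[OF _ that, of S]) (use F in \<open>auto simp: sep_def N_def\<close>)
    qed (use F in \<open>auto simp: sep_def\<close>)
    have near: "\<exists>A\<in>F. card (S \<inter> sym_diff (N v) A) \<le> (\<eta>/2) * card S" if v: "v \<in> S" for v
    proof (rule ccontr)
      assume c: "\<not> ?thesis"
      have "sep (Set.insert (N v) F)"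
        using F v c unfolding sep_def by (auto simp: Un_commute not_le intro: less_imp_le)
      then have "N v \<in> F" using max[of "Set.insert (N v) F"] by auto
      then have "\<not> card (S \<inter> sym_diff (N v) (N v)) \<le> (\<eta>/2) * card S" using c by blast
      then show False using assms by simp
    qed
    define cl where "cl v = (SOME A. A \<in> F \<and> card (S \<inter> sym_diff (N v) A) \<le> (\<eta>/2) * card S)" for v
    have cl: "cl v \<in> F \<and> card (S \<inter> sym_diff (N v) (cl v)) \<le> (\<eta>/2) * card S" if "v \<in> S" for v
      unfolding cl_def by (rule someI_ex) (use near[OF that] in blast)
    have finF: "finite F" using F S by (auto simp: sep_def intro: finite_subset)
    have "card (cl ` S) \<le> card F" using finF cl by (intro card_mono) auto
    then have "card (cl ` S) \<le> K" using \<open>card F \<le> K\<close> by simp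
    moreover have "card {x \<in> S. dist u x \<le> 1 \<and> \<not> dist v x \<le> 1} \<le> \<eta> * card S"
      if uv: "u \<in> S" "v \<in> S" "cl u = cl v" for u v
    proof -
      have "card {x \<in> S. dist u x \<le> 1 \<and> \<not> dist v x \<le> 1}
          \<le> card (S \<inter> sym_diff (N u) (cl u) \<union> S \<inter> sym_diff (N v) (cl v))"
        using S uv(3) by (intro card_mono) (auto simp: N_def)
      also have "\<dots> \<le> card (S \<inter> sym_diff (N u) (cl u)) + card (S \<inter> sym_diff (N v) (cl v))"
        by (rule card_Un_le)
      finally have "real (card {x \<in> S. dist u x \<le> 1 \<and> \<not> dist v x \<le> 1})
        \<le> card (S \<inter> sym_diff (N u) (cl u)) + card (S \<inter> sym_diff (N v) (cl v))" by linarith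
      also have "\<dots> \<le> (\<eta>/2) * card S + (\<eta>/2) * card S"
        using cl[OF uv(1)] cl[OF uv(2)] by (simp del: of_nat_add add: of_nat_add)
      finally show ?thesis by simp
    qed
    ultimately show ?thesis by blast
  qed auto
  then show ?thesis by (rule that)
qed

text \<open>The cells are half-open cubes of side \<open>1 / d\<close>, with \<open>d\<close> the
  dimension, so even their diameter in the 1-norm is at most 1. The index of a cell meeting the unit
  ball around \<open>v\<close> differs from that of \<open>v\<close> by an integer vector in the
  finite set \<open>R\<close>, which does not depend on \<open>v\<close>.\<close>

lemma unit_cells:
  obtains cell :: "real ^ 'd \<Rightarrow> int ^ 'd" and Q :: nat where
    "\<And>x y. cell x = cell y \<Longrightarrow> dist x y \<le> 1"
    "\<And>v. finite (cell ` {x. dist v x \<le> 1}) \<and> card (cell ` {x. dist v x \<le> 1}) \<le> Q"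
proof -
  define d where "d = real CARD('d)"
  have d: "d > 0" unfolding d_def by simp
  define cell :: "real ^ 'd \<Rightarrow> int ^ 'd" where "cell x = (\<chi> i. \<lfloor>d * x $ i\<rfloor>)" for x
  have "dist x y \<le> 1" if "cell x = cell y" for x y
  proof -
    have "\<bar>(x - y) $ i\<bar> \<le> 1 / d" for i
    proof -
      have "\<lfloor>d * x $ i\<rfloor> = \<lfloor>d * y $ i\<rfloor>" using that unfolding cell_def by (metis vec_lambda_beta)
      then have "\<bar>d * x $ i - d * y $ i\<bar> \<le> 1" by linarith
      then have "d * \<bar>(x - y) $ i\<bar> \<le> 1" using d by (simp add: abs_mult flip: right_diff_distrib)
      then show ?thesis using d by (simp add: field_simps)
    qed
    then have "(\<Sum>i\<in>UNIV. \<bar>(x - y) $ i\<bar>) \<le> (\<Sum>i\<in>(UNIV::'d set). 1 / d)" by (intro sum_mono)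
    also have "\<dots> = 1" using d unfolding d_def by simp
    finally show ?thesis using norm_le_l1_cart[of "x - y"] by (simp add: dist_norm)
  qed
  moreover
  define R where "R = {f :: int ^ 'd. \<forall>i. \<bar>f $ i\<bar> \<le> \<lceil>d\<rceil> + 1}"
  have finR: "finite R"
  proof -
    have "R \<subseteq> vec_lambda ` (UNIV \<rightarrow>\<^sub>E {- (\<lceil>d\<rceil> + 1)..\<lceil>d\<rceil> + 1})"
    proof
      fix f assume "f \<in> R"
      then have "($) f \<in> UNIV \<rightarrow>\<^sub>E {- (\<lceil>d\<rceil> + 1)..\<lceil>d\<rceil> + 1}"
        unfolding R_def by (auto simp: abs_le_iff) (smt (verit, best))
      then show "f \<in> vec_lambda ` (UNIV \<rightarrow>\<^sub>E {- (\<lceil>d\<rceil> + 1)..\<lceil>d\<rceil> + 1})"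
        by (metis imageI vec_nth_inverse)
    qed
    then show ?thesis by (rule finite_subset) (intro finite_imageI finite_PiE; simp)
  qed
  have sub: "cell ` {x. dist v x \<le> 1} \<subseteq> (\<lambda>f. \<chi> i. f $ i + cell v $ i) ` R" for v
  proof
    fix c assume "c \<in> cell ` {x. dist v x \<le> 1}"
    then obtain x where x: "c = cell x" "dist v x \<le> 1" by blast
    have "\<bar>\<lfloor>d * x $ i\<rfloor> - \<lfloor>d * v $ i\<rfloor>\<bar> \<le> \<lceil>d\<rceil> + 1" for i
    proof -
      have "\<bar>x $ i - v $ i\<bar> \<le> 1"
        using x(2) component_le_norm_cart[of "x - v" i] by (simp add: dist_norm norm_minus_commute)
      then have "\<bar>d * x $ i - d * v $ i\<bar> \<le> d"
        using d by (simp add: abs_mult flip: right_diff_distrib)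
      then show ?thesis by linarith
    qed
    then have "(\<chi> i. c $ i - cell v $ i) \<in> R" unfolding R_def x(1) cell_def by simp
    then show "c \<in> (\<lambda>f. \<chi> i. f $ i + cell v $ i) ` R"
      by (rule rev_image_eqI) (simp only: vec_eq_iff vec_lambda_beta, simp)
  qed
  have "finite (cell ` {x. dist v x \<le> 1}) \<and> card (cell ` {x. dist v x \<le> 1}) \<le> card R" for v
    using finite_subset[OF sub finite_imageI[OF finR]] surj_card_le[OF finR sub] by blast
  ultimately show ?thesis using that by metis
qed

section \<open>Alternating chains and cones\<close>

context vector_space
begin

text \<open>Rank-nullity phrased with generating sets, so that no quotient has to be formed. Each
  generator \<open>g\<close> costs at most one element \<open>w\<close> of \<open>Z\<close>: if the
  image of \<open>w\<close> really involves \<open>g\<close>, subtracting multiples of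
  \<open>w\<close> moves the images of all other elements into the span of the remaining
  generators.\<close>

lemma span_of_image_bound:
  assumes lin: "\<And>x y. f (x + y) = f x + f y" "\<And>a x. f (scale a x) = scale a (f x)"
    and "finite G" "subspace Z" "f ` Z \<subseteq> span (G \<union> B)"
  shows "\<exists>H\<subseteq>Z. finite H \<and> card H \<le> card G \<and> Z \<subseteq> span (H \<union> {z \<in> Z. f z \<in> span B})"
  using assms(3-5)
proof (induction G arbitrary: Z rule: finite_induct)
  case empty
  then have "Z \<subseteq> span ({} \<union> {z \<in> Z. f z \<in> span B})" by (auto intro: span_base)
  then show ?case by (intro exI[of _ "{}"]) auto
next
  case (insert g G)
  define Z0 where "Z0 = {z \<in> Z. f z \<in> span (G \<union> B)}"
  have diff: "f (x - y) = f x - f y" for x y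
    using lin(1)[of "x - y" y] by (simp add: algebra_simps)
  have f0: "f 0 = 0" using diff[of 0 0] by simp
  have Z0: "subspace Z0"
    using insert.prems(1) unfolding Z0_def subspace_def
    by (auto simp: lin f0 span_zero span_add span_scale)
  have eq: "{z \<in> Z0. f z \<in> span B} = {z \<in> Z. f z \<in> span B}"
    unfolding Z0_def using span_mono[of B "G \<union> B"] by auto
  have img: "f ` Z0 \<subseteq> span (G \<union> B)" unfolding Z0_def by auto
  obtain H where H: "H \<subseteq> Z0" "finite H" "card H \<le> card G" "Z0 \<subseteq> span (H \<union> {z \<in> Z. f z \<in> span B})"
    using insert.IH[OF Z0 img] unfolding eq by blast
  show ?case
  proof (cases "Z \<subseteq> Z0")
    case True
    then show ?thesis using H insert.hyps unfolding Z0_def by (intro exI[of _ H]) auto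
  next
    case False
    then obtain w where w: "w \<in> Z" "w \<notin> Z0" by auto
    have br: "\<exists>k. f z - scale k g \<in> span (G \<union> B)" if "z \<in> Z" for z
      using insert.prems(2) that by (force simp: span_insert)
    obtain a where a: "f w - scale a g \<in> span (G \<union> B)" using br w by blast
    have "a \<noteq> 0" using a w unfolding Z0_def by auto
    have "z \<in> span (Set.insert w H \<union> {z \<in> Z. f z \<in> span B})" if z: "z \<in> Z" for z
    proof -
      obtain b where b: "f z - scale b g \<in> span (G \<union> B)" using br z by blast
      \<comment> \<open>The factor cancels the coefficient of \<open>g\<close> in
        \<open>f z\<close>.\<close>
      define y where "y = z - scale (b / a) w"
      have "f y = (f z - scale b g) - scale (b / a) (f w - scale a g)"
        using \<open>a \<noteq> 0\<close> unfolding y_def by (simp add: diff lin(2) scale_right_diff_distrib)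
      then have "f y \<in> span (G \<union> B)" using a b by (metis span_diff span_scale)
      moreover have "y \<in> Z" unfolding y_def using z w insert.prems(1)
        by (intro subspace_diff subspace_scale) auto
      ultimately have "y \<in> span (H \<union> {z \<in> Z. f z \<in> span B})" using H(4) unfolding Z0_def by auto
      then have "y \<in> span (Set.insert w H \<union> {z \<in> Z. f z \<in> span B})"
        by (rule subsetD[OF span_mono, rotated]) auto
      moreover have "scale (b / a) w \<in> span (Set.insert w H \<union> {z \<in> Z. f z \<in> span B})"
        by (intro span_scale span_base) simp
      ultimately show ?thesis unfolding y_def by (metis diff_add_cancel span_add)
    qed
    moreover have "card (Set.insert w H) \<le> card (Set.insert g G)"
      using H insert.hyps w(2) by (auto simp: card_insert_if)
    ultimately show ?thesis
      using H(1,2) w(1) unfolding Z0_def by (intro exI[of _ "Set.insert w H"]) auto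
  qed
qed

end

section \<open>Functions into a field as a vector space, and alternating functions on lists\<close>

definition scale_fun :: "'k::field \<Rightarrow> ('b \<Rightarrow> 'k) \<Rightarrow> 'b \<Rightarrow> 'k" where
  "scale_fun a c = (\<lambda>x. a * c x)"

lemma scale_fun_apply [simp]: "scale_fun a c x = a * c x"
  by (simp add: scale_fun_def)

interpretation fun_space: vector_space "scale_fun :: 'k::field \<Rightarrow> ('b \<Rightarrow> 'k) \<Rightarrow> 'b \<Rightarrow> 'k"
  by unfold_locales (rule ext; simp add: distrib_left distrib_right mult.assoc)+

text \<open>Only adjacent swaps are mentioned, which suits induction on lists;
  \<open>alternating_iff_permutes\<close> recovers the condition imposed in
  \<open>oriented_chains\<close>.\<close>

definition alternating :: "('a list \<Rightarrow> 'k::field) \<Rightarrow> bool" where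
  "alternating c \<longleftrightarrow> (\<forall>us x y vs. c (us @ y # x # vs) = - c (us @ x # y # vs))"

lemma alternatingD: "alternating c \<Longrightarrow> c (us @ y # x # vs) = - c (us @ x # y # vs)"
  unfolding alternating_def by blast

lemma alternating_move:
  assumes "alternating c"
  shows "c (us @ x # ms @ vs) = (-1) ^ length ms * c (us @ ms @ x # vs)"
proof (induction ms arbitrary: us)
  case (Cons m ms)
  have "c (us @ x # (m # ms) @ vs) = - c ((us @ [m]) @ x # ms @ vs)"
    using alternatingD[OF assms, of us x m "ms @ vs"] by simp
  also have "\<dots> = - ((-1) ^ length ms * c ((us @ [m]) @ ms @ x # vs))"
    by (simp only: Cons.IH)
  finally show ?case by simp
qed simp

lemma alternating_exchange:
  assumes "alternating c"
  shows "c (us @ y # ms @ x # vs) = - c (us @ x # ms @ y # vs)"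
proof -
  have "c (us @ y # ms @ x # vs) = (-1) ^ length ms * c ((us @ ms) @ y # x # vs)"
    using alternating_move[OF assms, of us y ms "x # vs"] by simp
  also have "\<dots> = - ((-1) ^ length ms * c ((us @ ms) @ x # y # vs))"
    using alternatingD[OF assms, of "us @ ms" y x vs] by simp
  also have "(-1) ^ length ms * c ((us @ ms) @ x # y # vs) = c (us @ x # ms @ y # vs)"
    using alternating_move[OF assms, of us x ms "y # vs"] by simp
  finally show ?thesis .
qed

lemma permute_list_transpose_split:
  "permute_list (Transposition.transpose (length us) (length us + length ms + 1)) (us @ x # ms @ y # vs)
    = us @ y # ms @ x # vs"
  (is "permute_list ?\<pi> ?xs = ?ys")
proof (rule nth_equalityI)
  have p: "?\<pi> permutes {..<length ?xs}" by (intro permutes_swap_id) auto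
  fix i assume "i < length (permute_list ?\<pi> ?xs)"
  then have i: "i < length ?xs" by simp
  show "permute_list ?\<pi> ?xs ! i = ?ys ! i"
    unfolding permute_list_nth[OF p i]
    by (auto simp: Transposition.transpose_def nth_append nth_Cons' not_less)
qed simp

text \<open>Adjacent swaps are special permutations. Conversely, every permutation is a product of
  transpositions, and a transposition of positions exchanges two list entries, to which
  \<open>alternating_exchange\<close> applies.\<close>

lemma alternating_iff_permutes:
  "alternating c \<longleftrightarrow>
    (\<forall>xs \<pi>. \<pi> permutes {..<length xs} \<longrightarrow> c (permute_list \<pi> xs) = of_int (sign \<pi>) * c xs)"
  (is "?l \<longleftrightarrow> ?r")
proof
  assume r: ?r
  show ?l
    unfolding alternating_def
  proof (intro allI)
    fix us vs :: "'a list" and x y :: 'a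
    let ?\<pi> = "Transposition.transpose (length us) (length us + 1)"
    have "?\<pi> permutes {..<length (us @ x # y # vs)}" by (intro permutes_swap_id) auto
    then have "c (permute_list ?\<pi> (us @ x # y # vs)) = of_int (sign ?\<pi>) * c (us @ x # y # vs)"
      using r by blast
    then show "c (us @ y # x # vs) = - c (us @ x # y # vs)"
      using permute_list_transpose_split[of us "[]" x y vs] by (simp add: sign_swap_id)
  qed
next
  assume l: ?l
  have tr: "c (permute_list (Transposition.transpose a b) xs) = - c xs"
    if ab: "a < b" "b < length xs" for a b xs
  proof -
    define us ms vs where "us = take a xs" and "ms = take (b - a - 1) (drop (Suc a) xs)"
      and "vs = drop (Suc b) xs"
    have xs: "xs = us @ xs ! a # ms @ xs ! b # vs"
    proof -
      have "xs = us @ xs ! a # drop (Suc a) xs" using ab unfolding us_def by (simp add: id_take_nth_drop)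
      moreover have "drop (Suc a) xs = ms @ drop (b - a - 1) (drop (Suc a) xs)"
        by (simp only: ms_def append_take_drop_id)
      moreover have "drop (b - a - 1) (drop (Suc a) xs) = xs ! b # vs"
        using ab unfolding vs_def by (simp add: Cons_nth_drop_Suc)
      ultimately show ?thesis by metis
    qed
    have len: "length us = a" "a + length ms + 1 = b" using ab unfolding us_def ms_def by auto
    have "permute_list (Transposition.transpose a b) xs = us @ xs ! b # ms @ xs ! a # vs"
      using permute_list_transpose_split[of us ms "xs ! a" "xs ! b" vs] unfolding len xs[symmetric] .
    then show ?thesis using alternating_exchange[OF l] xs by metis
  qed
  have tr': "c (permute_list (Transposition.transpose a b) xs) = - c xs"
    if "a \<noteq> b" "a < length xs" "b < length xs" for a b xs
    using that tr by (metis linorder_neqE_nat transpose_commute)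
  show ?r
  proof (intro allI impI)
    fix xs :: "'a list" and \<pi> assume "\<pi> permutes {..<length xs}"
    then have "\<forall>ys. length ys = length xs \<longrightarrow> c (permute_list \<pi> ys) = of_int (sign \<pi>) * c ys"
      using finite_lessThan
    proof (induction \<pi> rule: permutes_induct)
      case (swap a b p)
      show ?case
      proof (intro allI impI)
        fix ys :: "'a list" assume ys: "length ys = length xs"
        have p: "permutation p" using swap permutation_permutes by blast
        have "c (permute_list (Transposition.transpose a b \<circ> p) ys)
            = c (permute_list p (permute_list (Transposition.transpose a b) ys))"
          using swap ys by (subst permute_list_compose) auto
        also have "\<dots> = of_int (sign p) * c (permute_list (Transposition.transpose a b) ys)"
          using swap ys by auto
        also have "\<dots> = of_int (sign p) * (- c ys)" using swap ys by (subst tr') auto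
        also have "of_int (sign p) * (- c ys) = of_int (sign (Transposition.transpose a b \<circ> p)) * c ys"
          using swap p by (simp add: sign_compose permutation_swap_id sign_swap_id)
        finally show "c (permute_list (Transposition.transpose a b \<circ> p) ys)
            = of_int (sign (Transposition.transpose a b \<circ> p)) * c ys" .
      qed
    qed auto
    then show "c (permute_list \<pi> xs) = of_int (sign \<pi>) * c xs" by blast
  qed
qed

section \<open>Clique complexes, link parts and cones\<close>

definition clique_complex :: "('a \<Rightarrow> 'a \<Rightarrow> bool) \<Rightarrow> 'a set \<Rightarrow> 'a set set" where
  "clique_complex E T = {\<sigma>. \<sigma> \<subseteq> T \<and> (\<forall>x\<in>\<sigma>. \<forall>y\<in>\<sigma>. E x y)}"

abbreviation clique_chains :: "('a \<Rightarrow> 'a \<Rightarrow> bool) \<Rightarrow> 'a set \<Rightarrow> nat \<Rightarrow> ('a list \<Rightarrow> 'k::field) set" where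
  "clique_chains E T m \<equiv> carrier (oriented_chains (clique_complex E T) m)"

lemma clique_chains_iff:
  assumes "finite T"
  shows "c \<in> clique_chains E T m \<longleftrightarrow> alternating c \<and>
    (\<forall>xs. c xs \<noteq> 0 \<longrightarrow> length xs = m \<and> distinct xs \<and> set xs \<subseteq> T \<and> (\<forall>x\<in>set xs. \<forall>y\<in>set xs. E x y))"
proof -
  \<comment> \<open>Finite support is automatic for lists of fixed length over a finite vertex
    set.\<close>
  have "finite {xs. c xs \<noteq> 0}"
    if "\<forall>xs. c xs \<noteq> 0 \<longrightarrow> length xs = m \<and> distinct xs \<and> set xs \<subseteq> T \<and> (\<forall>x\<in>set xs. \<forall>y\<in>set xs. E x y)"
    by (rule finite_subset[OF _ finite_lists_length_eq[OF assms, of m]]) (use that in auto)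
  then show ?thesis
    unfolding oriented_chains_def alternating_iff_permutes clique_complex_def by auto
qed

lemma boundary_eq_sum:
  assumes "finite T" "\<And>u. c (u # ys) \<noteq> 0 \<Longrightarrow> u \<in> T"
  shows "boundary c ys = (\<Sum>u\<in>T. c (u # ys))"
  unfolding boundary_def
  by (rule sum.mono_neutral_left) (use assms in auto)

text \<open>For a chain \<open>c\<close> this is the \<open>d\<close> in the decomposition
  \<open>c = v * d + c'\<close> with \<open>c'\<close> supported on simplices avoiding
  \<open>v\<close>.\<close>

definition link_part :: "'a \<Rightarrow> ('a list \<Rightarrow> 'k::field) \<Rightarrow> 'a list \<Rightarrow> 'k" where
  "link_part v c = (\<lambda>ys. c (v # ys))"

text \<open>\<open>cone_over v e\<close> is the join \<open>v * e\<close>: on a list it deletes \<open>v\<close> and applies \<open>e\<close>, with the sign of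
  moving \<open>v\<close> to the front.\<close>

primrec cone_over :: "'a \<Rightarrow> ('a list \<Rightarrow> 'k::field) \<Rightarrow> 'a list \<Rightarrow> 'k" where
  "cone_over v e [] = 0"
| "cone_over v e (x # xs) = (if x = v then e xs else 0) - cone_over v (\<lambda>ys. e (x # ys)) xs"

lemma cone_add: "cone_over v (\<lambda>ys. e ys + e' ys) xs = cone_over v e xs + cone_over v e' xs"
  by (induction xs arbitrary: e e') auto

lemma cone_minus: "cone_over v (\<lambda>ys. - e ys) xs = - cone_over v e xs"
  by (induction xs arbitrary: e) auto

lemma cone_zero: "cone_over v (\<lambda>ys. 0) xs = 0"
  by (induction xs) auto

lemma cone_sum: "cone_over v (\<lambda>ys. \<Sum>u\<in>T. e u ys) xs = (\<Sum>u\<in>T. cone_over v (e u) xs)"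
  by (induction T rule: infinite_finite_induct) (auto simp: cone_zero cone_add)

lemma cone_alternating:
  assumes "alternating e"
  shows "alternating (cone_over v e)"
proof -
  have "cone_over v e (us @ y # x # vs) = - cone_over v e (us @ x # y # vs)" for us x y vs
    using assms
  proof (induction us arbitrary: e)
    case Nil
    have "(\<lambda>zs. e (y # x # zs)) = (\<lambda>zs. - e (x # y # zs))"
      using alternatingD[OF Nil, of "[]" y x] by simp
    then show ?case by (simp add: cone_minus)
  next
    case (Cons u us)
    have "alternating (\<lambda>ys. e (u # ys))"
      using Cons.prems unfolding alternating_def by (metis append_Cons)
    from Cons.IH[OF this] show ?case
      using alternatingD[OF Cons.prems, of us y x vs] by simp
  qed
  then show ?thesis unfolding alternating_def by blast
qed

lemma cone_nonzeroD:
  assumes "cone_over v e xs \<noteq> 0"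
  shows "\<exists>us vs. xs = us @ v # vs \<and> e (us @ vs) \<noteq> 0"
  using assms
proof (induction xs arbitrary: e)
  case (Cons x xs)
  show ?case
  proof (cases "x = v \<and> e xs \<noteq> 0")
    case True
    then have "x # xs = [] @ v # xs \<and> e ([] @ xs) \<noteq> 0" by simp
    then show ?thesis by blast
  next
    case False
    then have "cone_over v (\<lambda>ys. e (x # ys)) xs \<noteq> 0" using Cons.prems by (auto split: if_splits)
    from Cons.IH[OF this] obtain us vs where "xs = us @ v # vs" "e (x # us @ vs) \<noteq> 0" by auto
    then have "x # xs = (x # us) @ v # vs \<and> e ((x # us) @ vs) \<noteq> 0" by simp
    then show ?thesis by blast
  qed
qed simp

lemma sum_fun_apply: "(sum f A) x = (\<Sum>a\<in>A. f a x)"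
  by (induction A rule: infinite_finite_induct) auto

text \<open>The cancellation behind the vanishing of the double boundary. The diagonal is a separate
  hypothesis because in characteristic 2 antisymmetry does not force it to vanish.\<close>

lemma antisymmetric_sum_eq_0:
  fixes g :: "'a \<Rightarrow> 'a \<Rightarrow> 'k::field"
  assumes "finite T" and anti: "\<And>u w. g u w = - g w u" and diag: "\<And>u. g u u = 0"
  shows "(\<Sum>u\<in>T. \<Sum>w\<in>T. g u w) = 0"
  using assms(1)
proof (induction T rule: finite_induct)
  case (insert t T)
  have "(\<Sum>u\<in>insert t T. \<Sum>w\<in>insert t T. g u w)
      = (\<Sum>w\<in>T. g t w) + (\<Sum>u\<in>T. g u t)"
    using insert by (simp add: sum.distrib diag)
  also have "(\<Sum>u\<in>T. g u t) = - (\<Sum>w\<in>T. g t w)"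
    unfolding sum_negf[symmetric] by (rule sum.cong[OF refl anti])
  finally show ?case by simp
qed simp

section \<open>Chains, cycles and boundaries of clique complexes\<close>

lemma clique_chainsI:
  assumes "finite T" "alternating c"
    "\<And>xs. c xs \<noteq> 0 \<Longrightarrow> length xs = m \<and> distinct xs \<and> set xs \<subseteq> T \<and> (\<forall>x\<in>set xs. \<forall>y\<in>set xs. E x y)"
  shows "c \<in> clique_chains E T m"
  using assms by (simp add: clique_chains_iff)

lemma clique_chains_alternating: "finite T \<Longrightarrow> c \<in> clique_chains E T m \<Longrightarrow> alternating c"
  by (simp add: clique_chains_iff)

lemma clique_chainsD:
  assumes "finite T" "c \<in> clique_chains E T m" "c xs \<noteq> 0"
  shows "length xs = m" "distinct xs" "set xs \<subseteq> T" "\<And>x y. x \<in> set xs \<Longrightarrow> y \<in> set xs \<Longrightarrow> E x y"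
  using assms by (auto simp: clique_chains_iff)

lemma subspace_clique_chains:
  assumes "finite T"
  shows "fun_space.subspace (clique_chains E T m :: ('a list \<Rightarrow> 'k::field) set)"
proof (rule fun_space.subspaceI)
  show "(0 :: 'a list \<Rightarrow> 'k) \<in> clique_chains E T m"
    using assms by (intro clique_chainsI) (auto simp: alternating_def)
next
  fix c c' :: "'a list \<Rightarrow> 'k" assume c: "c \<in> clique_chains E T m" "c' \<in> clique_chains E T m"
  show "c + c' \<in> clique_chains E T m"
  proof (rule clique_chainsI[OF assms])
    show "alternating (c + c')"
      using c[THEN clique_chains_alternating[OF assms]] unfolding alternating_def
      by (metis minus_add_distrib plus_fun_apply)
    fix xs assume "(c + c') xs \<noteq> 0"
    then have "c xs \<noteq> 0 \<or> c' xs \<noteq> 0" by auto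
    then show "length xs = m \<and> distinct xs \<and> set xs \<subseteq> T \<and> (\<forall>x\<in>set xs. \<forall>y\<in>set xs. E x y)"
      using c assms by (auto simp: clique_chains_iff)
  qed
next
  fix a and c :: "'a list \<Rightarrow> 'k" assume c: "c \<in> clique_chains E T m"
  show "scale_fun a c \<in> clique_chains E T m"
  proof (rule clique_chainsI[OF assms])
    show "alternating (scale_fun a c)"
      using clique_chains_alternating[OF assms c] unfolding alternating_def
      by (metis mult_minus_right scale_fun_apply)
  qed (use c assms in \<open>auto simp: clique_chains_iff\<close>)
qed

lemma clique_chains_mono:
  assumes "T \<subseteq> T'" "finite T'"
  shows "clique_chains E T m \<subseteq> clique_chains E T' m"
  using assms(1) unfolding clique_chains_iff[OF assms(2)] clique_chains_iff[OF finite_subset[OF assms]]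
    subset_iff by (metis (no_types, lifting))

lemma boundary_clique_chain:
  assumes "finite T" "c \<in> clique_chains E T m"
  shows "boundary c ys = (\<Sum>u\<in>T. c (u # ys))"
  using assms by (intro boundary_eq_sum) (auto dest: clique_chainsD(3)[OF assms])

lemma boundary_add:
  assumes "finite T" "c \<in> clique_chains E T m" "c' \<in> clique_chains E T m"
  shows "boundary (c + c') = boundary c + boundary c'"
  by (intro ext) (simp add: sum.distrib boundary_clique_chain[OF assms(1,2)]
    boundary_clique_chain[OF assms(1,3)] boundary_clique_chain[OF assms(1)
      fun_space.subspace_add[OF subspace_clique_chains[OF assms(1)] assms(2,3)]])

lemma boundary_scale:
  assumes "finite T" "c \<in> clique_chains E T m"
  shows "boundary (scale_fun a c) = scale_fun a (boundary c)"
  by (intro ext) (simp add: sum_distrib_left boundary_clique_chain[OF assms]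
    boundary_clique_chain[OF assms(1)
      fun_space.subspace_scale[OF subspace_clique_chains[OF assms(1)] assms(2)]])

lemma boundary_in_chains:
  assumes T: "finite T" and c: "c \<in> clique_chains E T (Suc m)"
  shows "boundary c \<in> clique_chains E T m"
proof (rule clique_chainsI[OF T])
  have "alternating (\<lambda>ys. c (u # ys))" for u
    using clique_chains_alternating[OF T c] unfolding alternating_def by (metis append_Cons)
  then have "c (u # us @ y # x # vs) = - c (u # us @ x # y # vs)" for u us x y vs
    unfolding alternating_def by blast
  then show "alternating (boundary c)"
    unfolding alternating_def boundary_clique_chain[OF T c] sum_negf[symmetric]
    by (intro allI sum.cong refl) blast
  fix ys assume "boundary c ys \<noteq> 0"
  then obtain u where "c (u # ys) \<noteq> 0"
    unfolding boundary_clique_chain[OF T c] by (meson sum.neutral)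
  then show "length ys = m \<and> distinct ys \<and> set ys \<subseteq> T \<and> (\<forall>x\<in>set ys. \<forall>y\<in>set ys. E x y)"
    using clique_chainsD[OF T c] by fastforce
qed

lemma boundary_boundary:
  assumes T: "finite T" and c: "c \<in> clique_chains E T (Suc m)"
  shows "boundary (boundary c) = (\<lambda>ys. 0)"
proof
  fix ys
  have "boundary (boundary c) ys = (\<Sum>u\<in>T. \<Sum>w\<in>T. c (w # u # ys))"
    using boundary_clique_chain[OF T boundary_in_chains[OF T c]] boundary_clique_chain[OF T c] by simp
  also have "\<dots> = 0"
  proof (rule antisymmetric_sum_eq_0[OF T])
    show "c (w # u # ys) = - c (u # w # ys)" for u w
      using alternatingD[OF clique_chains_alternating[OF T c], of "[]" w u ys] by simp
    show "c (u # u # ys) = 0" for u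
      using clique_chainsD(2)[OF T c, of "u # u # ys"] by auto
  qed
  finally show "boundary (boundary c) ys = 0" .
qed

abbreviation clique_cycles where "clique_cycles E T m \<equiv> cycles (clique_complex E T) m"
abbreviation clique_boundaries where "clique_boundaries E T m \<equiv> boundaries (clique_complex E T) m"

lemma subspace_cycles:
  assumes T: "finite T"
  shows "fun_space.subspace (clique_cycles E T m :: ('a list \<Rightarrow> 'k::field) set)"
proof (rule fun_space.subspaceI)
  note S = subspace_clique_chains[OF T, of E m, where 'k = 'k]
  show "(0 :: 'a list \<Rightarrow> 'k) \<in> clique_cycles E T m"
    using fun_space.subspace_0[OF S] by (auto simp: cycles_def boundary_def)
  fix c :: "'a list \<Rightarrow> 'k" assume c: "c \<in> clique_cycles E T m"
  show "c + c' \<in> clique_cycles E T m" if c': "c' \<in> clique_cycles E T m" for c'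
    using c c' boundary_add[OF T, of c E m c'] fun_space.subspace_add[OF S, of c c']
    by (auto simp: cycles_def fun_eq_iff)
  show "scale_fun a c \<in> clique_cycles E T m" for a
    using c boundary_scale[OF T, of c E m a] fun_space.subspace_scale[OF S, of c a]
    by (auto simp: cycles_def fun_eq_iff)
qed

lemma subspace_boundaries:
  assumes T: "finite T"
  shows "fun_space.subspace (clique_boundaries E T m :: ('a list \<Rightarrow> 'k::field) set)"
proof (rule fun_space.subspaceI)
  note S = subspace_clique_chains[OF T, of E "Suc m", where 'k = 'k]
  have "boundary (0 :: 'a list \<Rightarrow> 'k) = 0" by (auto simp: boundary_def fun_eq_iff)
  then show "(0 :: 'a list \<Rightarrow> 'k) \<in> clique_boundaries E T m"
    using fun_space.subspace_0[OF S] unfolding boundaries_def by (metis imageI)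
  fix c :: "'a list \<Rightarrow> 'k" assume "c \<in> clique_boundaries E T m"
  then obtain e where e: "c = boundary e" "e \<in> clique_chains E T (Suc m)"
    unfolding boundaries_def by blast
  show "c + c' \<in> clique_boundaries E T m" if c': "c' \<in> clique_boundaries E T m" for c'
  proof -
    from c' obtain e' where e': "c' = boundary e'" "e' \<in> clique_chains E T (Suc m)"
      unfolding boundaries_def by blast
    have "c + c' = boundary (e + e')" using boundary_add[OF T e(2) e'(2)] e e' by simp
    then show ?thesis using fun_space.subspace_add[OF S e(2) e'(2)] unfolding boundaries_def by blast
  qed
  show "scale_fun a c \<in> clique_boundaries E T m" for a
  proof -
    have "scale_fun a c = boundary (scale_fun a e)" using boundary_scale[OF T e(2)] e by simp
    then show ?thesis using fun_space.subspace_scale[OF S e(2)] unfolding boundaries_def by blast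
  qed
qed

lemma boundaries_subset_cycles:
  assumes T: "finite T"
  shows "clique_boundaries E T m \<subseteq> clique_cycles E T m"
  using boundary_in_chains[OF T] boundary_boundary[OF T] by (auto simp: boundaries_def cycles_def)

lemma cycles_mono: "T \<subseteq> T' \<Longrightarrow> finite T' \<Longrightarrow> clique_cycles E T m \<subseteq> clique_cycles E T' m"
  using clique_chains_mono by (fastforce simp: cycles_def)

lemma boundaries_mono: "T \<subseteq> T' \<Longrightarrow> finite T' \<Longrightarrow> clique_boundaries E T m \<subseteq> clique_boundaries E T' m"
  using clique_chains_mono by (fastforce simp: boundaries_def)

section \<open>Links and cones of chains\<close>

text \<open>A list containing \<open>v\<close> can be rearranged, up to sign, to begin with
  \<open>v\<close>, and there \<open>c\<close> vanishes.\<close>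

lemma chain_avoiding_vertex:
  assumes T: "finite T" and c: "c \<in> clique_chains E (insert v T) m" and z: "link_part v c = (\<lambda>ys. 0)"
  shows "c \<in> clique_chains E T m"
proof (rule clique_chainsI[OF T])
  have T': "finite (insert v T)" using T by simp
  show "alternating c" by (rule clique_chains_alternating[OF T' c])
  fix xs assume nz: "c xs \<noteq> 0"
  have "v \<notin> set xs"
  proof
    assume "v \<in> set xs"
    then obtain us vs where xs: "xs = us @ v # vs" by (meson split_list)
    have "c (v # us @ vs) = (-1) ^ length us * c xs"
      using alternating_move[OF clique_chains_alternating[OF T' c], of "[]" v us vs] xs by simp
    moreover have "c (v # us @ vs) = 0" using z unfolding link_part_def by metis
    ultimately show False using nz by simp
  qed
  then show "length xs = m \<and> distinct xs \<and> set xs \<subseteq> T \<and> (\<forall>x\<in>set xs. \<forall>y\<in>set xs. E x y)"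
    using clique_chainsD[OF T' c nz] by auto
qed

lemma link_part_in_chains:
  assumes T: "finite T" and c: "c \<in> clique_chains E (insert v T) (Suc m)"
  shows "link_part v c \<in> clique_chains E {u \<in> T. E v u} m"
proof (rule clique_chainsI)
  have T': "finite (insert v T)" using T by simp
  show "finite {u \<in> T. E v u}" using T by simp
  show "alternating (link_part v c)"
    using clique_chains_alternating[OF T' c] unfolding alternating_def link_part_def
    by (metis append_Cons)
  fix ys assume "link_part v c ys \<noteq> 0"
  then have "c (v # ys) \<noteq> 0" by (simp add: link_part_def)
  from clique_chainsD[OF T' c this]
  show "length ys = m \<and> distinct ys \<and> set ys \<subseteq> {u \<in> T. E v u} \<and> (\<forall>x\<in>set ys. \<forall>y\<in>set ys. E x y)"
    by auto
qed

text \<open>The sign comes from exchanging \<open>v\<close> with the summation vertex. In particular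
  the link part of a cycle is a cycle.\<close>

lemma boundary_link_part:
  assumes T: "finite T" and c: "c \<in> clique_chains E (insert v T) (Suc m)"
  shows "boundary (link_part v c) ys = - boundary c (v # ys)"
proof -
  have T': "finite (insert v T)" using T by simp
  have "boundary (link_part v c) ys = (\<Sum>u\<in>insert v T. c (v # u # ys))"
    using boundary_clique_chain[OF T' subsetD[OF clique_chains_mono link_part_in_chains[OF T c]]] T
    by (simp add: link_part_def subset_iff)
  also have "\<dots> = (\<Sum>u\<in>insert v T. - c (u # v # ys))"
  proof (intro sum.cong refl)
    show "c (v # u # ys) = - c (u # v # ys)" for u
      using alternatingD[OF clique_chains_alternating[OF T' c], of "[]" v u ys] by simp
  qed
  also have "\<dots> = - boundary c (v # ys)"
    unfolding boundary_clique_chain[OF T' c] by (rule sum_negf)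
  finally show ?thesis .
qed

lemma link_part_cycle:
  assumes T: "finite T" and c: "c \<in> clique_cycles E (insert v T) (Suc m)"
  shows "link_part v c \<in> clique_cycles E {u \<in> T. E v u} m"
  using c link_part_in_chains[OF T, of c E v m] boundary_link_part[OF T, of c E v m]
  unfolding cycles_def by auto

lemma cone_in_chains:
  assumes T: "finite T" "v \<notin> T" and nb: "\<And>u. u \<in> T \<Longrightarrow> E v u \<and> E u v" "E v v"
    and e: "e \<in> clique_chains E T m"
  shows "cone_over v e \<in> clique_chains E (insert v T) (Suc m)"
proof (rule clique_chainsI)
  show "alternating (cone_over v e)" by (rule cone_alternating[OF clique_chains_alternating[OF T(1) e]])
  fix xs assume "cone_over v e xs \<noteq> 0"
  from cone_nonzeroD[OF this]
  obtain us vs where xs: "xs = us @ v # vs" and nz: "e (us @ vs) \<noteq> 0" by auto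
  note D = clique_chainsD[OF T(1) e nz]
  have "v \<notin> set (us @ vs)" using D(3) T(2) by auto
  then show "length xs = Suc m \<and> distinct xs \<and> set xs \<subseteq> insert v T \<and> (\<forall>x\<in>set xs. \<forall>y\<in>set xs. E x y)"
    using D nb unfolding xs by (auto simp: subset_iff)
qed (use T in simp)

text \<open>In the sum over the first vertex \<open>u\<close>, the recursion for
  \<open>cone_over\<close> contributes \<open>e ys\<close> at \<open>u = v\<close>; the remaining
  terms add up, by linearity, to the cone over the boundary.\<close>

lemma boundary_cone:
  assumes T: "finite T" "v \<notin> T" and nb: "\<And>u. u \<in> T \<Longrightarrow> E v u \<and> E u v" "E v v"
    and e: "e \<in> clique_chains E T m"
  shows "boundary (cone_over v e) ys = e ys - cone_over v (boundary e) ys"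
proof -
  have T': "finite (insert v T)" using T by simp
  have e': "e \<in> clique_chains E (insert v T) m"
    using clique_chains_mono[of T "insert v T"] T' e by blast
  have be: "boundary e = (\<lambda>zs. \<Sum>u\<in>insert v T. e (u # zs))"
    using boundary_clique_chain[OF T' e'] by (rule ext)
  have "boundary (cone_over v e) ys = (\<Sum>u\<in>insert v T. cone_over v e (u # ys))"
    by (rule boundary_clique_chain[OF T' cone_in_chains[OF assms]])
  also have "\<dots> = (\<Sum>u\<in>insert v T. if u = v then e ys else 0)
      - (\<Sum>u\<in>insert v T. cone_over v (\<lambda>zs. e (u # zs)) ys)"
    unfolding cone_over.simps by (rule sum_subtractf)
  also have "\<dots> = e ys - cone_over v (boundary e) ys"
    unfolding be cone_sum using T' by simp
  finally show ?thesis .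
qed

lemma link_part_cone:
  assumes T: "finite T" "v \<notin> T" and e: "e \<in> clique_chains E T m"
  shows "link_part v (cone_over v e) = e"
proof
  fix ys
  have "(\<lambda>zs. e (v # zs)) = (\<lambda>zs. 0)" using clique_chainsD(3)[OF T(1) e] T(2) by fastforce
  then show "link_part v (cone_over v e) ys = e ys" by (simp add: link_part_def cone_zero)
qed

section \<open>Bounding Betti numbers\<close>

text \<open>Following the indexing of chain spaces by numbers of vertices, \<open>betti_le _ K m N\<close> bounds
  the reduced Betti number of \<open>K\<close> in dimension \<open>m - 1\<close> by \<open>N\<close>.\<close>

definition betti_le :: "'k::field itself \<Rightarrow> 'a set set \<Rightarrow> nat \<Rightarrow> nat \<Rightarrow> bool" where
  "betti_le _ K m N \<longleftrightarrow> (\<exists>F :: ('a list \<Rightarrow> 'k) set. F \<subseteq> cycles K m \<and> finite F \<and> card F \<le> N \<and>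
     cycles K m \<subseteq> fun_space.span (F \<union> boundaries K m))"

lemma betti_le_mono: "betti_le k K m N \<Longrightarrow> N \<le> N' \<Longrightarrow> betti_le k K m N'"
  unfolding betti_le_def by (meson le_trans)

lemma betti_le_0I:
  "cycles K m \<subseteq> (boundaries K m :: ('a list \<Rightarrow> 'k::field) set) \<Longrightarrow> betti_le TYPE('k) K m 0"
  unfolding betti_le_def using fun_space.span_superset by (intro exI[of _ "{}"]) fastforce

text \<open>The condition on \<open>m\<close> excludes dimension -1, where the complex consisting of
  the empty face has nonzero reduced homology.\<close>

lemma betti_le_empty:
  assumes "m > 0"
  shows "betti_le TYPE('k::field) (clique_complex E {}) m 0"
proof (rule betti_le_0I)
  have "c = 0" if c: "c \<in> clique_cycles E {} m" for c :: "'a list \<Rightarrow> 'k"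
  proof (rule ccontr)
    assume "c \<noteq> 0"
    then obtain xs where "c xs \<noteq> 0" by (auto simp: fun_eq_iff)
    then show False using clique_chainsD[of "{}" c E m xs] c assms by (auto simp: cycles_def)
  qed
  moreover have "(0 :: 'a list \<Rightarrow> 'k) \<in> clique_boundaries E {} m"
    using fun_space.subspace_0[OF subspace_boundaries] by blast
  ultimately show "clique_cycles E {} m \<subseteq> (clique_boundaries E {} m :: ('a list \<Rightarrow> 'k) set)" by blast
qed

text \<open>The Mayer-Vietoris estimate for gluing in the star of \<open>v\<close>, carried out on
  chains. Link parts of cycles are cycles of the link, where \<open>b\<close> generators suffice; a
  cycle whose link part bounds can be moved off \<open>v\<close> by a boundary, and then
  \<open>a\<close> generators suffice.\<close>

lemma betti_le_insert_vertex:
  assumes T: "finite T" "v \<notin> T" and E: "E v v" "\<And>u. u \<in> T \<Longrightarrow> E v u \<Longrightarrow> E u v"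
    and a: "betti_le TYPE('k::field) (clique_complex E T) (Suc m) a"
    and b: "betti_le TYPE('k) (clique_complex E {u \<in> T. E v u}) m b"
  shows "betti_le TYPE('k) (clique_complex E (insert v T)) (Suc m) (a + b)"
proof -
  let ?L = "{u \<in> T. E v u}"
  have T': "finite (insert v T)" and L: "finite ?L" "v \<notin> ?L" using T by auto
  have nb: "\<And>u. u \<in> ?L \<Longrightarrow> E v u \<and> E u v" using E by auto
  obtain F :: "('a list \<Rightarrow> 'k) set" where F: "F \<subseteq> clique_cycles E T (Suc m)" "finite F" "card F \<le> a"
    "clique_cycles E T (Suc m) \<subseteq> fun_space.span (F \<union> clique_boundaries E T (Suc m))"
    using a unfolding betti_le_def by blast
  obtain G :: "('a list \<Rightarrow> 'k) set" where G: "finite G" "card G \<le> b"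
    "clique_cycles E ?L m \<subseteq> fun_space.span (G \<union> clique_boundaries E ?L m)"
    using b unfolding betti_le_def by blast
  let ?Z = "clique_cycles E (insert v T) (Suc m) :: ('a list \<Rightarrow> 'k) set"
  let ?B = "clique_boundaries E (insert v T) (Suc m) :: ('a list \<Rightarrow> 'k) set"
  have lin: "link_part v (x + y) = link_part v x + link_part v y"
    "link_part v (scale_fun r x) = scale_fun r (link_part v x)" for x y :: "'a list \<Rightarrow> 'k" and r
    by (auto simp: link_part_def fun_eq_iff)
  have img: "link_part v ` ?Z \<subseteq> fun_space.span (G \<union> clique_boundaries E ?L m)"
    using link_part_cycle[OF T(1)] G(3) by blast
  obtain H where H: "H \<subseteq> ?Z" "finite H" "card H \<le> card G"
    "?Z \<subseteq> fun_space.span (H \<union> {z \<in> ?Z. link_part v z \<in> fun_space.span (clique_boundaries E ?L m)})"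
    using fun_space.span_of_image_bound[where f = "link_part v", OF lin G(1) subspace_cycles[OF T'] img]
    by blast
  have FZ: "F \<subseteq> ?Z" using F(1) cycles_mono[of T "insert v T"] T' by blast
  have spanB: "fun_space.span (clique_boundaries E ?L m :: ('a list \<Rightarrow> 'k) set) = clique_boundaries E ?L m"
    using subspace_boundaries[OF L(1)] by (simp add: fun_space.span_eq_iff)
  have key: "c \<in> fun_space.span (F \<union> ?B)"
    if c: "c \<in> ?Z" and lk: "link_part v c \<in> clique_boundaries E ?L m" for c
  proof -
    obtain e where e: "e \<in> clique_chains E ?L (Suc m)" "link_part v c = boundary e"
      using lk unfolding boundaries_def by blast
    have ce: "cone_over v e \<in> clique_chains E (insert v T) (Suc (Suc m))"
      using cone_in_chains[OF L nb E(1) e(1)] clique_chains_mono[of "insert v ?L" "insert v T"] T' by blast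
    \<comment> \<open>The link part of the boundary of \<open>v * e\<close> is minus the boundary of
      \<open>e\<close>, so the link part of \<open>c'\<close> vanishes and \<open>c'\<close> avoids
      \<open>v\<close>.\<close>
    define c' where "c' = c + boundary (cone_over v e)"
    have bB: "boundary (cone_over v e) \<in> ?B" using ce unfolding boundaries_def by blast
    have c'Z: "c' \<in> ?Z" unfolding c'_def
      using fun_space.subspace_add[OF subspace_cycles[OF T'] c] bB boundaries_subset_cycles[OF T'] by blast
    have "link_part v c' ys = 0" for ys
    proof -
      have "boundary e \<in> clique_chains E ?L m" by (rule boundary_in_chains[OF L(1) e(1)])
      then have 1: "cone_over v (boundary e) (v # ys) = boundary e ys"
        using link_part_cone[OF L] unfolding link_part_def by metis
      have "e (v # ys) = 0" using clique_chainsD(3)[OF L(1) e(1), of "v # ys"] L(2) by auto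
      then have "boundary (cone_over v e) (v # ys) = - boundary e ys"
        using boundary_cone[OF L nb E(1) e(1), of "v # ys"] 1 by simp
      then show ?thesis using e(2) unfolding c'_def link_part_def by (simp add: fun_eq_iff)
    qed
    then have "c' \<in> clique_cycles E T (Suc m)"
      using chain_avoiding_vertex[OF T(1), of c' E v "Suc m"] c'Z unfolding cycles_def by auto
    then have "c' \<in> fun_space.span (F \<union> clique_boundaries E T (Suc m))" using F(4) by blast
    moreover have "clique_boundaries E T (Suc m) \<subseteq> ?B"
      using T' by (intro boundaries_mono) auto
    ultimately have "c' \<in> fun_space.span (F \<union> ?B)"
      using fun_space.span_mono[of "F \<union> clique_boundaries E T (Suc m)" "F \<union> ?B"] by blast
    moreover have "boundary (cone_over v e) \<in> fun_space.span (F \<union> ?B)"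
      using bB by (intro fun_space.span_base) auto
    moreover have "c = c' - boundary (cone_over v e)" by (simp add: c'_def)
    ultimately show ?thesis by (metis fun_space.span_diff)
  qed
  have "H \<union> {z \<in> ?Z. link_part v z \<in> fun_space.span (clique_boundaries E ?L m)}
      \<subseteq> fun_space.span ((H \<union> F) \<union> ?B)"
  proof
    fix z assume "z \<in> H \<union> {z \<in> ?Z. link_part v z \<in> fun_space.span (clique_boundaries E ?L m)}"
    then show "z \<in> fun_space.span ((H \<union> F) \<union> ?B)"
    proof
      assume "z \<in> H" then show ?thesis by (intro fun_space.span_base) auto
    next
      assume "z \<in> {z \<in> ?Z. link_part v z \<in> fun_space.span (clique_boundaries E ?L m)}"
      then have "z \<in> fun_space.span (F \<union> ?B)" using key unfolding spanB by blast
      then show ?thesis using fun_space.span_mono[of "F \<union> ?B" "(H \<union> F) \<union> ?B"] by blast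
    qed
  qed
  then have "?Z \<subseteq> fun_space.span ((H \<union> F) \<union> ?B)"
    using H(4) fun_space.span_minimal[OF _ fun_space.subspace_span] by blast
  moreover have "card (H \<union> F) \<le> a + b" using card_Un_le[of H F] H(3) F(3) G(2) by linarith
  ultimately show ?thesis unfolding betti_le_def using H(1,2) F(2) FZ by (intro exI[of _ "H \<union> F"]) auto
qed

text \<open>A cone is acyclic. Write \<open>c = e + u * d\<close> with \<open>d\<close> the link
  part at \<open>u\<close> and \<open>e\<close> avoiding \<open>u\<close>; the cycle condition gives
  \<open>boundary e = - d\<close>, so \<open>c\<close> is the boundary of
  \<open>u * e\<close>.\<close>

lemma betti_le_apex:
  assumes T: "finite T" "u \<in> T" and E: "\<And>x. x \<in> T \<Longrightarrow> E u x \<and> E x u"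
  shows "betti_le TYPE('k::field) (clique_complex E T) m 0"
proof (rule betti_le_0I, rule subsetI)
  fix c :: "'a list \<Rightarrow> 'k" assume c: "c \<in> clique_cycles E T m"
  define T0 where "T0 = T - {u}"
  have T0: "T = insert u T0" "finite T0" "u \<notin> T0" using T unfolding T0_def by auto
  have nb: "\<And>x. x \<in> T0 \<Longrightarrow> E u x \<and> E x u" "E u u" using E T unfolding T0_def by auto
  have nbT0: "{x \<in> T0. E u x} = T0" using nb by auto
  have "\<exists>e\<in>clique_chains E T0 m. boundary (cone_over u e) = c"
  proof (cases m)
    \<comment> \<open>In dimension -1 there is no link part to split off; \<open>c\<close> itself
      serves as \<open>e\<close>.\<close>
    case 0
    have "link_part u c = (\<lambda>ys. 0)"
      using clique_chainsD(1)[OF T(1), of c E 0] c 0 unfolding link_part_def cycles_def by fastforce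
    then have c0: "c \<in> clique_chains E T0 m"
      using chain_avoiding_vertex[OF T0(2), of c E u m] c T0(1) unfolding cycles_def by auto
    have "boundary (cone_over u c) = c"
      using boundary_cone[OF T0(2,3) nb c0] c by (auto simp: cycles_def cone_zero)
    then show ?thesis using c0 by blast
  next
    case (Suc k)
    define d where "d = link_part u c"
    have d: "d \<in> clique_cycles E T0 k"
      using link_part_cycle[OF T0(2), of c E u k] c unfolding d_def Suc T0(1) nbT0 by simp
    then have dC: "d \<in> clique_chains E T0 k" and bd: "boundary d = (\<lambda>ys. 0)" by (auto simp: cycles_def)
    have cd: "cone_over u d \<in> clique_chains E T m"
      using cone_in_chains[OF T0(2,3) nb dC] unfolding Suc T0(1) .
    have cC: "c \<in> clique_chains E T m" and bc: "boundary c = (\<lambda>ys. 0)" using c by (auto simp: cycles_def)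
    define e where "e = c - cone_over u d"
    have "e \<in> clique_chains E T m"
      unfolding e_def by (rule fun_space.subspace_diff[OF subspace_clique_chains[OF T(1)] cC cd])
    moreover have "link_part u e = (\<lambda>ys. 0)"
      using link_part_cone[OF T0(2,3) dC] unfolding e_def d_def link_part_def by (auto simp: fun_eq_iff)
    ultimately have eC: "e \<in> clique_chains E T0 m"
      using chain_avoiding_vertex[OF T0(2)] unfolding T0(1) by blast
    have "c = e + cone_over u d" by (simp add: e_def)
    then have "boundary c = boundary e + boundary (cone_over u d)"
      using boundary_add[OF T(1) subsetD[OF clique_chains_mono eC] cd] T(1) T0(1) by auto
    moreover have "boundary (cone_over u d) = d"
      using boundary_cone[OF T0(2,3) nb dC] bd by (auto simp: cone_zero)
    ultimately have "boundary e = (\<lambda>ys. - d ys)"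
      using bc by (auto simp: fun_eq_iff eq_neg_iff_add_eq_0)
    then have "boundary (cone_over u e) = c"
      using boundary_cone[OF T0(2,3) nb eC] by (auto simp: e_def cone_minus)
    then show ?thesis using eC by blast
  qed
  then show "c \<in> clique_boundaries E T m"
    using cone_in_chains[where E = E, OF T0(2,3) nb] unfolding boundaries_def T0(1) by blast
qed

section \<open>Dimension 0: points and connected components\<close>

definition point_chain :: "'a \<Rightarrow> 'a list \<Rightarrow> 'k::field" where
  "point_chain x = (\<lambda>xs. if xs = [x] then 1 else 0)"

lemma point_chain_in_chains:
  assumes "finite T" "x \<in> T" "E x x"
  shows "point_chain x \<in> clique_chains E T 1"
  using assms by (intro clique_chainsI) (auto simp: point_chain_def alternating_def split: if_splits)

lemma boundary_point_chain: "boundary (point_chain x) = (\<lambda>ys. if ys = [] then 1 else 0)"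
proof
  fix ys
  have "{v. point_chain x (v # ys) \<noteq> (0::'b)} = (if ys = [] then {x} else {})"
    by (auto simp: point_chain_def)
  then show "boundary (point_chain x) ys = (if ys = [] then 1 else (0::'b))"
    by (auto simp: boundary_def point_chain_def)
qed

text \<open>The edge is the cone from \<open>x\<close> over the point \<open>y\<close>. Equal
  endpoints are treated apart, since the apex of a cone must lie outside its base.\<close>

lemma point_diff_edge:
  assumes T: "finite T" "x \<in> T" "y \<in> T" and E: "E x y" "E y x" "E x x" "E y y"
  shows "(point_chain y - point_chain x :: 'a list \<Rightarrow> 'k::field) \<in> clique_boundaries E T 1"
proof (cases "x = y")
  case True
  then show ?thesis using fun_space.subspace_0[OF subspace_boundaries[OF T(1)]] by (metis diff_self)
next
  case False
  let ?p = "point_chain y :: 'a list \<Rightarrow> 'k"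
  have Y: "finite {y}" "x \<notin> {y}" and nb: "\<And>u. u \<in> {y} \<Longrightarrow> E x u \<and> E u x" using False E by auto
  have p: "?p \<in> clique_chains E {y} 1" using E by (intro point_chain_in_chains) auto
  \<comment> \<open>The boundary of a point is the empty simplex, and the cone from \<open>x\<close>
    over the empty simplex is the point \<open>x\<close>.\<close>
  have cx: "cone_over x (\<lambda>ys. if ys = [] then 1 else 0) = (point_chain x :: 'a list \<Rightarrow> 'k)"
  proof
    fix xs show "cone_over x (\<lambda>ys. if ys = [] then 1 else 0) xs = (point_chain x xs :: 'k)"
      by (cases xs) (auto simp: point_chain_def cone_zero)
  qed
  have "boundary (cone_over x ?p) = ?p - point_chain x"
    using boundary_cone[OF Y nb E(3) p] by (auto simp: boundary_point_chain cx)
  moreover have "cone_over x ?p \<in> clique_chains E T (Suc 1)"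
    using cone_in_chains[OF Y nb E(3) p] clique_chains_mono[of "{x,y}" T E "Suc 1"] T by blast
  ultimately show ?thesis unfolding boundaries_def by (metis imageI)
qed

definition joined_in :: "('a \<Rightarrow> 'a \<Rightarrow> bool) \<Rightarrow> 'a set \<Rightarrow> 'a \<Rightarrow> 'a \<Rightarrow> bool" where
  "joined_in E T = (\<lambda>x y. x \<in> T \<and> y \<in> T \<and> E x y)\<^sup>*\<^sup>*"

text \<open>Paths make every point homologous to some \<open>r\<close> in \<open>R\<close>, so the
  differences of the points \<open>r\<close> and the point \<open>r0\<close> generate reduced
  homology in dimension 0; \<open>r = r0\<close> contributes nothing. \<open>R\<close> has to meet
  every component, possibly more than once.\<close>

lemma betti_le_components:
  assumes T: "finite T" and R: "R \<subseteq> T" "r0 \<in> R"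
    and E: "\<And>x. E x x" "\<And>x y. E x y \<Longrightarrow> E y x"
    and conn: "\<And>x. x \<in> T \<Longrightarrow> \<exists>r\<in>R. joined_in E T r x"
  shows "betti_le TYPE('k::field) (clique_complex E T) 1 (card R - 1)"
proof -
  let ?p = "point_chain :: 'a \<Rightarrow> 'a list \<Rightarrow> 'k"
  let ?B = "clique_boundaries E T 1 :: ('a list \<Rightarrow> 'k) set"
  define F where "F = (\<lambda>r. ?p r - ?p r0) ` (R - {r0})"
  have finR: "finite R" using R T finite_subset by blast
  have cardF: "card F \<le> card R - 1"
    unfolding F_def using finR R(2) by (metis card_Diff_singleton card_image_le finite_Diff)
  have pC: "?p x \<in> clique_chains E T 1" if "x \<in> T" for x
    by (rule point_chain_in_chains[OF T that E(1)])
  have r0T: "r0 \<in> T" using R by auto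
  have diffC: "?p x - ?p y \<in> clique_cycles E T 1" if "x \<in> T" "y \<in> T" for x y
  proof -
    have "?p x - ?p y \<in> clique_chains E T 1"
      by (rule fun_space.subspace_diff[OF subspace_clique_chains[OF T] pC[OF that(1)] pC[OF that(2)]])
    moreover have "boundary (?p x) = boundary (?p x - ?p y) + boundary (?p y)"
      using boundary_add[OF T calculation pC[OF that(2)]] by simp
    ultimately show ?thesis
      unfolding cycles_def boundary_point_chain by (auto simp: fun_eq_iff)
  qed
  have FZ: "F \<subseteq> clique_cycles E T 1" unfolding F_def using diffC R r0T by blast
  have path: "?p x - ?p r \<in> ?B" if "joined_in E T r x" for r x
    using that unfolding joined_in_def
  proof (induction rule: rtranclp_induct)
    case base
    show ?case unfolding diff_self by (rule fun_space.subspace_0[OF subspace_boundaries[OF T]])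
  next
    case (step y z)
    then have "?p z - ?p y \<in> ?B" using point_diff_edge[OF T, of y z E] E by blast
    moreover have e: "?p z - ?p r = (?p z - ?p y) + (?p y - ?p r)" by simp
    ultimately show ?case
      unfolding e by (intro fun_space.subspace_add[OF subspace_boundaries[OF T]] step.IH)
  qed
  have pt: "?p x - ?p r0 \<in> fun_space.span (F \<union> ?B)" if xT: "x \<in> T" for x
  proof -
    obtain r where r: "r \<in> R" "joined_in E T r x" using conn[OF xT] by blast
    have "?p x - ?p r \<in> fun_space.span (F \<union> ?B)"
      using path[OF r(2)] by (intro fun_space.span_base) auto
    moreover have "?p r - ?p r0 \<in> fun_space.span (F \<union> ?B)"
    proof (cases "r = r0")
      case True
      then show ?thesis using fun_space.span_zero by (metis diff_self)
    next
      case False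
      then show ?thesis using r unfolding F_def by (intro fun_space.span_base) auto
    qed
    moreover have "?p x - ?p r0 = (?p x - ?p r) + (?p r - ?p r0)" by simp
    ultimately show ?thesis by (metis fun_space.span_add)
  qed
  have "c \<in> fun_space.span (F \<union> ?B)" if c: "c \<in> clique_cycles E T 1" for c
  proof -
    have cC: "c \<in> clique_chains E T 1" and bc: "boundary c = (\<lambda>ys. 0)" using c by (auto simp: cycles_def)
    have sum0: "(\<Sum>x\<in>T. c [x]) = 0"
      using boundary_clique_chain[OF T cC, of "[]"] bc by simp
    \<comment> \<open>The augmentation makes the coefficients of a cycle sum to 0, so subtracting
      the point \<open>r0\<close> from every point changes nothing.\<close>
    have "c = (\<Sum>x\<in>T. scale_fun (c [x]) (?p x - ?p r0))"
    proof
      fix xs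
      have "(\<Sum>x\<in>T. scale_fun (c [x]) (?p x - ?p r0)) xs
          = (\<Sum>x\<in>T. c [x] * ?p x xs) - (\<Sum>x\<in>T. c [x]) * ?p r0 xs"
        by (simp add: sum_fun_apply right_diff_distrib sum_subtractf sum_distrib_right)
      also have "\<dots> = (\<Sum>x\<in>T. c [x] * ?p x xs)" by (simp add: sum0)
      also have "\<dots> = c xs"
      proof (cases "c xs = 0")
        case True
        then show ?thesis by (intro trans[OF sum.neutral]) (auto simp: point_chain_def)
      next
        case False
        then obtain z where z: "xs = [z]" "z \<in> T"
          using clique_chainsD[OF T cC, of xs] by (auto simp: length_Suc_conv)
        have "(\<Sum>x\<in>T. c [x] * ?p x xs) = (\<Sum>x\<in>T. if x = z then c [x] else 0)"
          by (intro sum.cong) (auto simp: point_chain_def z)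
        then show ?thesis using z T by simp
      qed
      finally show "c xs = (\<Sum>x\<in>T. scale_fun (c [x]) (?p x - ?p r0)) xs" by simp
    qed
    moreover have "(\<Sum>x\<in>T. scale_fun (c [x]) (?p x - ?p r0)) \<in> fun_space.span (F \<union> ?B)"
      by (intro fun_space.span_sum fun_space.span_scale pt)
    ultimately show ?thesis by simp
  qed
  then show ?thesis
    unfolding betti_le_def using FZ cardF finR by (intro exI[of _ F]) (auto simp: F_def)
qed

section \<open>Dimension of the homology space\<close>

lemma vectorspace_class_ring_iff_module:
  "vectorspace (class_ring :: 'k::field ring) V \<longleftrightarrow> module (class_ring :: 'k ring) V"
  unfolding vectorspace_def using class_field by blast

text \<open>Scalar multiples of cosets are defined as unions over all representatives. All
  representatives yield the same coset, so the union is that coset.\<close>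

lemma quotient_module_facts:
  assumes V: "module (class_ring :: 'k::field ring) V" and W: "submodule (class_ring :: 'k::field ring) W V"
  shows abelian_subgroup_quotient: "abelian_subgroup W V"
    and smult_quotient: "\<And>x a. x \<in> carrier V \<Longrightarrow>
      a \<odot>\<^bsub>quotient_module V W\<^esub> (W +>\<^bsub>V\<^esub> x) = W +>\<^bsub>V\<^esub> (a \<odot>\<^bsub>V\<^esub> x)"
proof -
  interpret V: module class_ring V by (rule V)
  interpret W: submodule class_ring W V by (rule W)
  have sub: "additive_subgroup W V"
  proof (rule additive_subgroupI, rule V.add.subgroupI)
    show "W \<subseteq> carrier V" by (rule W.subset)
    show "W \<noteq> {}" using W.zero_closed by blast
    show "\<ominus>\<^bsub>V\<^esub> a \<in> W" if a: "a \<in> W" for a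
    proof -
      have "(- 1) \<odot>\<^bsub>V\<^esub> a = \<ominus>\<^bsub>V\<^esub> a"
        using V.smult_minus_1[of a] a W.subset by (auto simp: class_ring_simps)
      then show ?thesis using W.smult_closed[of "- 1" a] a by simp
    qed
  qed auto
  show ab: "abelian_subgroup W V"
    by (rule abelian_subgroupI3[OF sub V.abelian_group_axioms])
  then interpret W': abelian_subgroup W V .
  fix x a assume x: "x \<in> carrier V"
  have "W +>\<^bsub>V\<^esub> (a \<odot>\<^bsub>V\<^esub> y) = W +>\<^bsub>V\<^esub> (a \<odot>\<^bsub>V\<^esub> x)" if y: "y \<in> W +>\<^bsub>V\<^esub> x" for y
  proof -
    obtain w where w: "w \<in> W" "y = w \<oplus>\<^bsub>V\<^esub> x" using y by (auto simp: a_r_coset_def')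
    have "a \<odot>\<^bsub>V\<^esub> y = a \<odot>\<^bsub>V\<^esub> w \<oplus>\<^bsub>V\<^esub> a \<odot>\<^bsub>V\<^esub> x"
      using w x W.subset by (auto intro!: V.smult_r_distr)
    moreover have "a \<odot>\<^bsub>V\<^esub> w \<in> W" using w W.smult_closed by auto
    ultimately have "a \<odot>\<^bsub>V\<^esub> y \<in> W +>\<^bsub>V\<^esub> (a \<odot>\<^bsub>V\<^esub> x)" by (auto simp: a_r_coset_def')
    then show ?thesis using x W'.a_repr_independence'[of "a \<odot>\<^bsub>V\<^esub> y" "a \<odot>\<^bsub>V\<^esub> x"] by auto
  qed
  moreover have "x \<in> W +>\<^bsub>V\<^esub> x" by (rule W'.a_rcos_self[OF x])
  ultimately have "(\<Union>y\<in>W +>\<^bsub>V\<^esub> x. W +>\<^bsub>V\<^esub> (a \<odot>\<^bsub>V\<^esub> y)) = W +>\<^bsub>V\<^esub> (a \<odot>\<^bsub>V\<^esub> x)"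
    by blast
  then show "a \<odot>\<^bsub>quotient_module V W\<^esub> (W +>\<^bsub>V\<^esub> x) = W +>\<^bsub>V\<^esub> (a \<odot>\<^bsub>V\<^esub> x)"
    by (simp add: quotient_module_def)
qed

lemma module_quotient_module:
  assumes V: "module (class_ring :: 'k::field ring) V" and W: "submodule (class_ring :: 'k::field ring) W V"
  shows "module (class_ring :: 'k ring) (quotient_module V W)"
proof -
  interpret V: module class_ring V by (rule V)
  interpret W: abelian_subgroup W V by (rule abelian_subgroup_quotient[OF assms])
  note sm = smult_quotient[OF assms]
  let ?Q = "quotient_module V W"
  have car: "carrier ?Q = {W +>\<^bsub>V\<^esub> x | x. x \<in> carrier V}"
    by (auto simp: quotient_module_def A_RCOSETS_def')
  have add: "(W +>\<^bsub>V\<^esub> x) \<oplus>\<^bsub>?Q\<^esub> (W +>\<^bsub>V\<^esub> y) = W +>\<^bsub>V\<^esub> (x \<oplus>\<^bsub>V\<^esub> y)"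
    if "x \<in> carrier V" "y \<in> carrier V" for x y
    using W.a_rcos_sum[OF that] by (simp add: quotient_module_def)
  have zero: "\<zero>\<^bsub>?Q\<^esub> = W +>\<^bsub>V\<^esub> \<zero>\<^bsub>V\<^esub>"
    using W.a_rcos_const[of "\<zero>\<^bsub>V\<^esub>"] by (simp add: quotient_module_def)
  have "abelian_group ?Q"
  proof (rule abelian_groupI)
    fix X Y X' assume "X \<in> carrier ?Q"
    then obtain x where x: "x \<in> carrier V" "X = W +>\<^bsub>V\<^esub> x" unfolding car by blast
    show "\<zero>\<^bsub>?Q\<^esub> \<oplus>\<^bsub>?Q\<^esub> X = X" using x add[of "\<zero>\<^bsub>V\<^esub>" x] zero by simp
    have "(W +>\<^bsub>V\<^esub> (\<ominus>\<^bsub>V\<^esub> x)) \<oplus>\<^bsub>?Q\<^esub> X = \<zero>\<^bsub>?Q\<^esub>"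
      using x add[of "\<ominus>\<^bsub>V\<^esub> x" x] zero by (simp add: V.l_neg)
    then show "\<exists>Y\<in>carrier ?Q. Y \<oplus>\<^bsub>?Q\<^esub> X = \<zero>\<^bsub>?Q\<^esub>" using x(1) unfolding car by blast
    assume "Y \<in> carrier ?Q"
    then obtain y where y: "y \<in> carrier V" "Y = W +>\<^bsub>V\<^esub> y" unfolding car by blast
    show "X \<oplus>\<^bsub>?Q\<^esub> Y \<in> carrier ?Q" using x y add[of x y] unfolding car by auto
    show "X \<oplus>\<^bsub>?Q\<^esub> Y = Y \<oplus>\<^bsub>?Q\<^esub> X" using x y add by (simp add: V.a_comm)
    assume "X' \<in> carrier ?Q"
    then obtain z where z: "z \<in> carrier V" "X' = W +>\<^bsub>V\<^esub> z" unfolding car by blast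
    show "(X \<oplus>\<^bsub>?Q\<^esub> Y) \<oplus>\<^bsub>?Q\<^esub> X' = X \<oplus>\<^bsub>?Q\<^esub> (Y \<oplus>\<^bsub>?Q\<^esub> X')"
      using x y z add by (simp add: V.a_assoc)
  qed (use zero in \<open>auto simp: car\<close>)
  then show ?thesis
  proof (rule moduleI[OF class_cring.is_cring])
    fix a b :: 'k and X Y assume "X \<in> carrier ?Q"
    then obtain x where x: "x \<in> carrier V" "X = W +>\<^bsub>V\<^esub> x" unfolding car by blast
    show "a \<odot>\<^bsub>?Q\<^esub> X \<in> carrier ?Q" using x sm unfolding car by auto
    show "(a \<oplus>\<^bsub>class_ring\<^esub> b) \<odot>\<^bsub>?Q\<^esub> X = a \<odot>\<^bsub>?Q\<^esub> X \<oplus>\<^bsub>?Q\<^esub> b \<odot>\<^bsub>?Q\<^esub> X"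
      using x sm add V.smult_l_distr[of a b x] by auto
    show "(a \<otimes>\<^bsub>class_ring\<^esub> b) \<odot>\<^bsub>?Q\<^esub> X = a \<odot>\<^bsub>?Q\<^esub> (b \<odot>\<^bsub>?Q\<^esub> X)"
      using x sm V.smult_assoc1[of a b x] by auto
    show "\<one>\<^bsub>class_ring\<^esub> \<odot>\<^bsub>?Q\<^esub> X = X"
      using x sm V.smult_one[of x] by auto
    assume "Y \<in> carrier ?Q"
    then obtain y where y: "y \<in> carrier V" "Y = W +>\<^bsub>V\<^esub> y" unfolding car by blast
    show "a \<odot>\<^bsub>?Q\<^esub> (X \<oplus>\<^bsub>?Q\<^esub> Y) = a \<odot>\<^bsub>?Q\<^esub> X \<oplus>\<^bsub>?Q\<^esub> a \<odot>\<^bsub>?Q\<^esub> Y"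
      using x y sm add V.smult_r_distr[of a x y] by auto
  qed
qed

text \<open>The passage from spans of functions to the dimension of the quotient: boundaries have
  the zero coset, so the cosets of \<open>F\<close> generate the homology space, and the dimension
  is at most the size of a generating set.\<close>

lemma reduced_betti_le:
  assumes T: "finite T" and b: "betti_le TYPE('k::field) (clique_complex E T) (Suc p) N"
  shows "reduced_betti TYPE('k) p (clique_complex E T) \<le> N"
proof -
  let ?K = "clique_complex E T"
  define Z where "Z = (cycles ?K (Suc p) :: ('a list \<Rightarrow> 'k) set)"
  define W where "W = (boundaries ?K (Suc p) :: ('a list \<Rightarrow> 'k) set)"
  define V where "V = (oriented_chains ?K (Suc p) :: ('k, 'a list \<Rightarrow> 'k) module)\<lparr>carrier := Z\<rparr>"
  have sZ: "fun_space.subspace Z" and sW: "fun_space.subspace W" and WZ: "W \<subseteq> Z"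
    unfolding Z_def W_def
    by (rule subspace_cycles[OF T] subspace_boundaries[OF T] boundaries_subset_cycles[OF T])+
  have V_simps: "carrier V = Z" "\<zero>\<^bsub>V\<^esub> = 0" "\<And>c d. c \<oplus>\<^bsub>V\<^esub> d = c + d" "\<And>a c. a \<odot>\<^bsub>V\<^esub> c = scale_fun a c"
    by (auto simp: V_def oriented_chains_def fun_eq_iff)
  have mV: "module (class_ring :: 'k ring) V"
  proof (rule moduleI[OF class_cring.is_cring])
    show "abelian_group V"
    proof (rule abelian_groupI)
      fix x assume "x \<in> carrier V"
      then show "\<exists>y\<in>carrier V. y \<oplus>\<^bsub>V\<^esub> x = \<zero>\<^bsub>V\<^esub>"
        using fun_space.subspace_neg[OF sZ] by (intro bexI[of _ "- x"]) (auto simp: V_simps)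
    qed (auto simp: V_simps fun_space.subspace_add[OF sZ] fun_space.subspace_0[OF sZ] algebra_simps)
  qed (auto simp: V_simps fun_space.subspace_scale[OF sZ] fun_space.scale_left_distrib
      fun_space.scale_right_distrib)
  have mW: "submodule (class_ring :: 'k ring) W V"
    using mV WZ sW unfolding submodule_def by (auto simp: V_simps fun_space.subspace_def)
  let ?Q = "quotient_module V W"
  interpret W: abelian_subgroup W V by (rule abelian_subgroup_quotient[OF mV mW])
  have vs: "vectorspace (class_ring :: 'k ring) ?Q"
    unfolding vectorspace_class_ring_iff_module by (rule module_quotient_module[OF mV mW])
  then interpret Q: vectorspace "class_ring :: 'k ring" ?Q .
  have car: "carrier ?Q = {W +>\<^bsub>V\<^esub> x | x. x \<in> carrier V}"
    by (auto simp: quotient_module_def A_RCOSETS_def')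
  have add: "(W +>\<^bsub>V\<^esub> x) \<oplus>\<^bsub>?Q\<^esub> (W +>\<^bsub>V\<^esub> y) = W +>\<^bsub>V\<^esub> (x + y)"
    if "x \<in> Z" "y \<in> Z" for x y
    using W.a_rcos_sum[of x y] that by (simp add: quotient_module_def V_simps)
  have smult: "a \<odot>\<^bsub>?Q\<^esub> (W +>\<^bsub>V\<^esub> x) = W +>\<^bsub>V\<^esub> scale_fun a x" if "x \<in> Z" for a x
    using smult_quotient[OF mV mW, of x a] that by (simp add: V_simps)
  have zero: "\<zero>\<^bsub>?Q\<^esub> = W" by (simp add: quotient_module_def)
  have W0: "W +>\<^bsub>V\<^esub> w = W" if "w \<in> W" for w
    using W.a_rcos_const[OF that] .
  obtain F where F: "F \<subseteq> Z" "finite F" "card F \<le> N" "Z \<subseteq> fun_space.span (F \<union> W)"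
    using b unfolding betti_le_def Z_def W_def by blast
  define G where "G = (\<lambda>c. W +>\<^bsub>V\<^esub> c) ` F"
  have G: "G \<subseteq> carrier ?Q" "finite G" "card G \<le> N"
    using F card_image_le[of F "\<lambda>c. W +>\<^bsub>V\<^esub> c"] unfolding G_def car V_simps by auto
  have subm: "submodule class_ring (Q.span G) ?Q" by (rule Q.span_is_submodule[OF G(1)])
  have "c \<in> Z \<and> W +>\<^bsub>V\<^esub> c \<in> Q.span G" if "c \<in> fun_space.span (F \<union> W)" for c
    using that
  proof (induction rule: fun_space.span_induct_alt)
    case base
    have "0 \<in> W" using sW by (rule fun_space.subspace_0)
    then show ?case using W0 WZ submodule.zero_closed[OF subm] zero by (metis subsetD)
  next
    case (step a x y)
    have x: "x \<in> Z \<and> W +>\<^bsub>V\<^esub> x \<in> Q.span G"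
    proof (cases "x \<in> F")
      case True
      then show ?thesis using F(1) Q.in_own_span[OF G(1)] unfolding G_def by auto
    next
      case False
      then show ?thesis using step WZ W0 submodule.zero_closed[OF subm] zero by auto
    qed
    have ax: "scale_fun a x \<in> Z" using x fun_space.subspace_scale[OF sZ] by blast
    have "W +>\<^bsub>V\<^esub> scale_fun a x \<in> Q.span G"
      using submodule.smult_closed[OF subm, of a "W +>\<^bsub>V\<^esub> x"] x smult by auto
    then have "W +>\<^bsub>V\<^esub> (scale_fun a x + y) \<in> Q.span G"
      using submodule.m_closed[OF subm] step add ax by metis
    then show ?case using fun_space.subspace_add[OF sZ ax] step by blast
  qed
  then have "carrier ?Q \<subseteq> Q.span G" using F(4) unfolding car V_simps by blast
  then have "Q.gen_set G" using Q.span_is_subset2[OF G(1)] by blast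
  then have "Q.dim \<le> card G" using Q.gen_ge_dim G by blast
  then show ?thesis
    using G(3) unfolding reduced_betti_def reduced_homology_def V_def W_def Z_def by simp
qed

section \<open>Graphs with cells and neighbourhood classes\<close>

text \<open>Iterates \<open>betti_le_insert_vertex\<close> in the order of \<open>idx\<close>,
  starting from \<open>A\<close>. It serves twice: for building a link from the mates of a vertex,
  and for building the whole complex from the empty set.\<close>

lemma betti_le_filtration:
  fixes idx :: "'a \<Rightarrow> nat"
  assumes E: "\<And>x. E x x" "\<And>x y. E x y \<Longrightarrow> E y x"
    and T: "finite T" "A \<subseteq> T" "inj_on idx T"
    and base: "betti_le TYPE('k::field) (clique_complex E A) (Suc m) a"
    and step: "\<And>w. w \<in> T - A \<Longrightarrow>
      betti_le TYPE('k) (clique_complex E {u \<in> T. E w u \<and> (u \<in> A \<or> idx u < idx w)}) m (b w)"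
  shows "betti_le TYPE('k) (clique_complex E T) (Suc m) (a + (\<Sum>w\<in>T - A. b w))"
  using T step
proof (induction "card (T - A)" arbitrary: T)
  case 0
  then have "T = A" by auto
  then show ?case using base by simp
next
  case (Suc n)
  have fin: "finite (T - A)" "T - A \<noteq> {}" using Suc by (auto simp: card_gt_0_iff)
  have "Max (idx ` (T - A)) \<in> idx ` (T - A)" using fin by (intro Max_in) auto
  then obtain w where w: "w \<in> T - A" and wM: "idx w = Max (idx ` (T - A))" by (metis imageE)
  have wmax: "idx u \<le> idx w" if "u \<in> T - A" for u using that fin(1) unfolding wM by (intro Max_ge) auto
  have lt: "idx u < idx w" if "u \<in> T - A" "u \<noteq> w" for u
    using w wmax[OF that(1)] that inj_onD[OF Suc.prems(3), of u w] by (auto simp: le_less)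
  define T' where "T' = T - {w}"
  have T': "finite T'" "A \<subseteq> T'" "inj_on idx T'" "w \<notin> T'" "T = insert w T'"
    using Suc.prems w unfolding T'_def by (auto intro: inj_on_diff)
  have diff: "T - A = insert w (T' - A)" "w \<notin> T' - A" using T' w by auto
  have "betti_le TYPE('k) (clique_complex E T') (Suc m) (a + (\<Sum>w\<in>T' - A. b w))"
  proof (rule Suc.hyps(1))
    show "n = card (T' - A)" using Suc.hyps(2) diff fin by (simp add: card_insert_if)
    fix z assume z: "z \<in> T' - A"
    \<comment> \<open>Removing \<open>w\<close> leaves the links of the other vertices unchanged,
      because \<open>w\<close> is outside \<open>A\<close> and comes last.\<close>
    have "{u \<in> T'. E z u \<and> (u \<in> A \<or> idx u < idx z)} = {u \<in> T. E z u \<and> (u \<in> A \<or> idx u < idx z)}"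
      using z T' w wmax[of z] by auto
    then show "betti_le TYPE('k) (clique_complex E {u \<in> T'. E z u \<and> (u \<in> A \<or> idx u < idx z)}) m (b z)"
      using Suc.prems(4)[of z] z T' by auto
  qed (use T' in auto)
  moreover have "{u \<in> T. E w u \<and> (u \<in> A \<or> idx u < idx w)} = {u \<in> T'. E w u}"
    using T' w lt by auto
  then have "betti_le TYPE('k) (clique_complex E {u \<in> T'. E w u}) m (b w)"
    using Suc.prems(4)[OF w] by simp
  ultimately have "betti_le TYPE('k) (clique_complex E (insert w T')) (Suc m)
      (a + (\<Sum>w\<in>T' - A. b w) + b w)"
    using T' E by (intro betti_le_insert_vertex) auto
  then show ?case using T'(1) diff by (simp add: T'(5)[symmetric] add.commute add.left_commute)
qed

text \<open>Collects all that the counting uses of the geometry, with \<open>E\<close> standing for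
  distance at most 1: cells are cliques, a neighbourhood meets few cells, and there are few classes
  with similar neighbourhoods. The injection \<open>idx\<close> fixes the order in which vertices
  are added.\<close>

locale cell_graph =
  fixes E :: "'a \<Rightarrow> 'a \<Rightarrow> bool" and S :: "'a set"
    and cell :: "'a \<Rightarrow> 'c" and cl :: "'a \<Rightarrow> 'e" and Q K e :: nat and idx :: "'a \<Rightarrow> nat"
  assumes refl: "E x x" and sym: "E x y \<Longrightarrow> E y x" and fin: "finite S"
    and cell: "cell x = cell y \<Longrightarrow> E x y"
    and Q: "v \<in> S \<Longrightarrow> card (cell ` {x \<in> S. E v x}) \<le> Q"
    and K: "card (cl ` S) \<le> K"
    and near: "u \<in> S \<Longrightarrow> v \<in> S \<Longrightarrow> cl u = cl v \<Longrightarrow> card {x \<in> S. E u x \<and> \<not> E v x} \<le> e"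
    and idx: "inj_on idx S"
begin

text \<open>The vertices of the link of \<open>v\<close> at the moment when \<open>v\<close> is
  added.\<close>

definition older :: "'a \<Rightarrow> 'a set" where
  "older v = {u \<in> S. E v u \<and> idx u < idx v}"

definition mates :: "'a \<Rightarrow> 'a set" where
  "mates v = {u \<in> older v. cell u = cell v}"

text \<open>The link of \<open>v\<close> is built up by first adding the points in the cell of \<open>v\<close> and then the others
  in the order of \<open>idx\<close>; \<open>common v w\<close> spans the link of \<open>w\<close> at the stage when it is added.\<close>

definition common :: "'a \<Rightarrow> 'a \<Rightarrow> 'a set" where
  "common v w = {u \<in> older v. E w u \<and> (u \<in> mates v \<or> idx u < idx w)}"

text \<open>An empty \<open>common v w\<close> counts as connected, in line with its vanishing
  reduced homology in dimension 0.\<close>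

definition bad :: "'a \<Rightarrow> 'a set" where
  "bad v = {w \<in> older v - mates v. \<not> (\<forall>x\<in>common v w. \<forall>y\<in>common v w. joined_in E (common v w) x y)}"

lemma finite_older [simp]: "finite (older v)" and finite_common [simp]: "finite (common v w)"
  and finite_bad [simp]: "finite (bad v)"
  using fin by (auto simp: older_def common_def bad_def)

text \<open>If \<open>w\<close> is not bad, one representative reaches everything. Otherwise one
  representative per cell does, since cells are cliques, and \<open>common v w\<close> meets at most
  \<open>Q\<close> cells because it lies in the neighbourhood of \<open>v\<close>.\<close>

lemma betti_le_common:
  assumes "v \<in> S" "w \<in> older v - mates v"
  shows "betti_le TYPE('k::field) (clique_complex E (common v w)) 1 (if w \<in> bad v then Q else 0)"
proof (cases "common v w = {}")
  case True
  then show ?thesis using betti_le_mono[OF betti_le_empty[of 1 E, where 'k = 'k]] by auto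
next
  case False
  then obtain r0 where r0: "r0 \<in> common v w" by blast
  show ?thesis
  proof (cases "w \<in> bad v")
    case False
    then have "joined_in E (common v w) r0 x" if "x \<in> common v w" for x
      using that r0 assms(2) unfolding bad_def by blast
    then have "betti_le TYPE('k) (clique_complex E (common v w)) 1 (card {r0} - 1)"
      using r0 refl sym by (intro betti_le_components) auto
    then show ?thesis using False by simp
  next
    case True
    define rep where "rep c = (SOME x. x \<in> common v w \<and> cell x = c)" for c
    have rep: "rep (cell x) \<in> common v w \<and> cell (rep (cell x)) = cell x" if "x \<in> common v w" for x
      unfolding rep_def by (rule someI[of "\<lambda>y. y \<in> common v w \<and> cell y = cell x" x]) (use that in simp)
    define R where "R = rep ` cell ` common v w"
    have "betti_le TYPE('k) (clique_complex E (common v w)) 1 (card R - 1)"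
    proof (rule betti_le_components[where ?r0.0 = "rep (cell r0)"])
      show "R \<subseteq> common v w" "rep (cell r0) \<in> R" using rep r0 unfolding R_def by auto
      fix x assume x: "x \<in> common v w"
      have "joined_in E (common v w) (rep (cell x)) x"
        using rep[OF x] x cell[of "rep (cell x)" x] unfolding joined_in_def by (intro r_into_rtranclp) auto
      then show "\<exists>r\<in>R. joined_in E (common v w) r x" using x unfolding R_def by blast
    qed (use refl sym in auto)
    moreover have "card R - 1 \<le> Q"
    proof -
      have "card R \<le> card (cell ` common v w)" unfolding R_def by (intro card_image_le) auto
      also have "\<dots> \<le> card (cell ` {x \<in> S. E v x})"
        using fin by (intro card_mono) (auto simp: common_def older_def)
      also have "\<dots> \<le> Q" by (rule Q[OF assms(1)])
      finally show ?thesis by simp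
    qed
    ultimately show ?thesis using True betti_le_mono by auto
  qed
qed

text \<open>The starting set \<open>mates v\<close> lies in one cell, hence is a clique and acyclic
  unless empty; afterwards only the bad \<open>w\<close> can create homology in dimension 1.\<close>

lemma betti_le_older:
  assumes "v \<in> S"
  shows "betti_le TYPE('k::field) (clique_complex E (older v)) 2 (Q * card (bad v))"
proof -
  have "betti_le TYPE('k) (clique_complex E (mates v)) (Suc 1) 0"
  proof (cases "mates v = {}")
    case True
    then show ?thesis using betti_le_empty[of "Suc 1" E, where 'k = 'k] by simp
  next
    case False
    then obtain u where u: "u \<in> mates v" by blast
    have "finite (mates v)" by (simp add: mates_def)
    moreover have "E u x \<and> E x u" if "x \<in> mates v" for x
      using that u cell[of u x] cell[of x u] by (simp add: mates_def)
    ultimately show ?thesis using betti_le_apex[OF _ u] by blast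
  qed
  moreover have "betti_le TYPE('k) (clique_complex E {u \<in> older v. E w u \<and> (u \<in> mates v \<or> idx u < idx w)}) 1
      (if w \<in> bad v then Q else 0)" if "w \<in> older v - mates v" for w
    using betti_le_common[OF assms that] unfolding common_def .
  ultimately have "betti_le TYPE('k) (clique_complex E (older v)) (Suc 1)
      (0 + (\<Sum>w\<in>older v - mates v. if w \<in> bad v then Q else 0))"
    using refl sym idx
    by (intro betti_le_filtration[where idx = idx]) (auto simp: mates_def older_def fin intro: inj_on_subset)
  moreover have "(\<Sum>w\<in>older v - mates v. if w \<in> bad v then Q else 0) = Q * card (bad v)"
  proof -
    have "(older v - mates v) \<inter> {w. w \<in> bad v} = bad v" by (auto simp: bad_def)
    then show ?thesis by (simp add: sum.If_cases)
  qed
  ultimately show ?thesis by (simp add: numeral_2_eq_2)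
qed

lemma betti_le_bad: "betti_le TYPE('k::field) (clique_complex E S) 3 (\<Sum>v\<in>S. Q * card (bad v))"
proof -
  have "betti_le TYPE('k) (clique_complex E {u \<in> S. E w u \<and> (u \<in> {} \<or> idx u < idx w)}) 2
      (Q * card (bad w))" if "w \<in> S - {}" for w
    using betti_le_older[of w] that unfolding older_def by auto
  then have "betti_le TYPE('k) (clique_complex E S) (Suc 2) (0 + (\<Sum>v\<in>S - {}. Q * card (bad v)))"
    using refl sym fin idx by (intro betti_le_filtration[where idx = idx] betti_le_empty) auto
  then show ?thesis by (simp add: numeral_3_eq_3 numeral_2_eq_2)
qed

text \<open>The first vertex for each combination of cell and class. Every other vertex has an
  earlier \<open>u\<close> to be compared with.\<close>

definition leaders :: "'a set" where
  "leaders = {v \<in> S. \<forall>u\<in>S. cell u = cell v \<longrightarrow> cl u = cl v \<longrightarrow> idx v \<le> idx u}"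

text \<open>Both the bad \<open>w\<close> not adjacent to \<open>u\<close> and, through the
  injection \<open>x\<close>, those adjacent to \<open>u\<close> are counted by the neighbours of
  \<open>v\<close> that \<open>u\<close> misses; hence the factor 2.\<close>

lemma card_bad_cell_le:
  assumes v: "v \<in> S" and u: "u \<in> S" "cell u = cell v" "cl u = cl v" "idx u < idx v"
  shows "card {w \<in> bad v. cell w = B} \<le> 2 * e"
proof -
  define X where "X = {w \<in> bad v. cell w = B \<and> E u w}"
  have uv: "E v u" using u(2) cell by metis
  have um: "u \<in> mates v" using u uv by (simp add: mates_def older_def)
  have "\<exists>x. x \<in> common v w \<and> \<not> joined_in E (common v w) u x" if w: "w \<in> X" for w
  proof (rule ccontr)
    assume "\<not> ?thesis"
    then have j: "\<And>x. x \<in> common v w \<Longrightarrow> joined_in E (common v w) u x" by simp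
    have sy: "symp (joined_in E (common v w))"
      unfolding joined_in_def by (rule symp_rtranclp) (auto simp: symp_def sym)
    have "joined_in E (common v w) x y" if xy: "x \<in> common v w" "y \<in> common v w" for x y
    proof -
      have "joined_in E (common v w) x u" by (rule sympD[OF sy j[OF xy(1)]])
      then show ?thesis using j[OF xy(2)] unfolding joined_in_def by (rule rtranclp_trans)
    qed
    moreover have "w \<in> bad v" using w by (simp add: X_def)
    ultimately show False unfolding bad_def by blast
  qed
  then have "\<forall>w\<in>X. \<exists>x. x \<in> common v w \<and> \<not> joined_in E (common v w) u x" by blast
  from bchoice[OF this] obtain x
    where x: "\<And>w. w \<in> X \<Longrightarrow> x w \<in> common v w \<and> \<not> joined_in E (common v w) u (x w)" by blast
  have Xo: "w \<in> older v" "cell w = B" "E u w" if "w \<in> X" for w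
    using that by (auto simp: X_def bad_def)
  \<comment> \<open>Since \<open>u\<close> is a mate of \<open>v\<close>, it belongs to
    \<open>common v w\<close> whatever the order of \<open>u\<close> and \<open>w\<close>.\<close>
  have uc: "u \<in> common v w" if "w \<in> X" for w
    using um Xo[OF that] sym by (auto simp: common_def mates_def)
  have sub: "x ` X \<subseteq> {x \<in> S. E v x \<and> \<not> E u x}"
  proof
    fix y assume "y \<in> x ` X"
    then obtain w where w: "w \<in> X" "y = x w" by blast
    \<comment> \<open>An edge within \<open>common v w\<close> would join \<open>u\<close> to
      \<open>y\<close>.\<close>
    have "\<not> E u y"
      using x[OF w(1)] uc[OF w(1)] w(2) unfolding joined_in_def by (auto intro: r_into_rtranclp)
    then show "y \<in> {x \<in> S. E v x \<and> \<not> E u x}"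
      using x[OF w(1)] w(2) by (auto simp: common_def older_def)
  qed
  have less: "x w' \<noteq> x w" if w: "w \<in> X" "w' \<in> X" "idx w' < idx w" for w w'
  proof
    assume eq: "x w' = x w"
    let ?C = "common v w"
    \<comment> \<open>The path runs from \<open>u\<close> over \<open>w'\<close> to
      \<open>x w\<close>: the earlier \<open>w'\<close> lies in \<open>common v w\<close> because it
      shares the cell of \<open>w\<close>, it is adjacent to \<open>u\<close> by the choice of
      \<open>X\<close>, and to \<open>x w = x w'\<close> because that point lies in
      \<open>common v w'\<close>.\<close>
    have "E w w'" using Xo[OF w(1)] Xo[OF w(2)] cell by metis
    then have w'C: "w' \<in> ?C" using Xo[OF w(2)] w(3) by (auto simp: common_def)
    have "E w' (x w)" using x[OF w(2)] eq by (simp add: common_def)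
    let ?R = "\<lambda>p q. p \<in> ?C \<and> q \<in> ?C \<and> E p q"
    have "?R\<^sup>*\<^sup>* u w'" by (rule r_into_rtranclp) (use w'C uc[OF w(1)] Xo[OF w(2)] in blast)
    then have "?R\<^sup>*\<^sup>* u (x w)"
      by (rule rtranclp.rtrancl_into_rtrancl) (use w'C x[OF w(1)] \<open>E w' (x w)\<close> in blast)
    then have "joined_in E ?C u (x w)" unfolding joined_in_def .
    then show False using x[OF w(1)] by blast
  qed
  have "inj_on x X"
  proof (rule inj_onI)
    fix w w' assume w: "w \<in> X" "w' \<in> X" "x w = x w'"
    have "idx w = idx w'" using less[of w w'] less[of w' w] w by (metis linorder_neqE_nat)
    moreover have "w \<in> S" "w' \<in> S" using w Xo by (auto simp: older_def)
    ultimately show "w = w'" using idx by (auto dest: inj_onD)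
  qed
  then have "card X \<le> card {x \<in> S. E v x \<and> \<not> E u x}"
    using sub fin by (intro card_inj_on_le[of x]) auto
  also have "\<dots> \<le> e" using near[OF v u(1)] u(3) by simp
  finally have cX: "card X \<le> e" .
  have "{w \<in> bad v. cell w = B} \<subseteq> {x \<in> S. E v x \<and> \<not> E u x} \<union> X"
    by (auto simp: X_def bad_def older_def)
  then have "card {w \<in> bad v. cell w = B} \<le> card ({x \<in> S. E v x \<and> \<not> E u x} \<union> X)"
    using fin by (intro card_mono) (auto simp: X_def)
  also have "\<dots> \<le> card {x \<in> S. E v x \<and> \<not> E u x} + card X" by (rule card_Un_le)
  also have "\<dots> \<le> 2 * e" using cX near[OF v u(1)] u(3) by simp
  finally show ?thesis .
qed

lemma card_bad_le:
  assumes v: "v \<in> S - leaders"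
  shows "card (bad v) \<le> Q * (2 * e)"
proof -
  obtain u where u: "u \<in> S" "cell u = cell v" "cl u = cl v" "idx u < idx v"
    using v unfolding leaders_def by (auto simp: not_le)
  have "bad v = (\<Union>B\<in>cell ` {x \<in> S. E v x}. {w \<in> bad v. cell w = B})"
    by (auto simp: bad_def older_def)
  then have "card (bad v) \<le> (\<Sum>B\<in>cell ` {x \<in> S. E v x}. card {w \<in> bad v. cell w = B})"
    using fin card_UN_le[of "cell ` {x \<in> S. E v x}" "\<lambda>B. {w \<in> bad v. cell w = B}"] by simp
  also have "\<dots> \<le> (\<Sum>B\<in>cell ` {x \<in> S. E v x}. 2 * e)"
    using card_bad_cell_le[OF _ u] v by (intro sum_mono) auto
  also have "\<dots> \<le> Q * (2 * e)" using Q[of v] v by simp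
  finally show ?thesis .
qed

text \<open>The number of cells, and so of leaders, may grow with \<open>S\<close>; therefore pairs
  are counted from the side of \<open>w\<close>. The leaders adjacent to \<open>w\<close> occupy at
  most \<open>Q\<close> cells and are determined by cell and class.\<close>

lemma sum_bad_leaders_le: "(\<Sum>v\<in>leaders. card (bad v)) \<le> card S * (Q * K)"
proof -
  have finL: "finite leaders" using fin by (simp add: leaders_def)
  have "(\<Sum>v\<in>leaders. card (bad v)) \<le> (\<Sum>v\<in>leaders. card {w \<in> S. E v w})"
    using fin by (intro sum_mono card_mono) (auto simp: bad_def older_def)
  also have "\<dots> = (\<Sum>w\<in>S. card {v \<in> leaders. E v w})"
    by (rule sum_multicount_gen[OF finL fin]) simp
  also have "\<dots> \<le> (\<Sum>w\<in>S. Q * K)"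
  proof (rule sum_mono)
    fix w assume w: "w \<in> S"
    have "inj_on (\<lambda>v. (cell v, cl v)) leaders"
    proof (rule inj_onI)
      fix x y assume "x \<in> leaders" "y \<in> leaders" "(cell x, cl x) = (cell y, cl y)"
      then have "x \<in> S" "y \<in> S" "idx x = idx y" by (auto simp: leaders_def intro: antisym)
      then show "x = y" using idx by (auto dest: inj_onD)
    qed
    then have "card {v \<in> leaders. E v w} \<le> card (cell ` {x \<in> S. E w x} \<times> cl ` S)"
      using fin sym by (intro card_inj_on_le[of "\<lambda>v. (cell v, cl v)"])
        (auto simp: leaders_def intro: inj_on_subset)
    also have "\<dots> \<le> Q * K" unfolding card_cartesian_product by (intro mult_mono Q[OF w] K) auto
    finally show "card {v \<in> leaders. E v w} \<le> Q * K" .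
  qed
  finally show ?thesis by simp
qed

text \<open>The first summand comes from the vertices that are not leaders, the second from the
  leaders. With \<open>e\<close> a small fraction of \<open>card S\<close>, only the first is
  quadratic in \<open>card S\<close>.\<close>

lemma betti_le_cell_graph:
  "betti_le TYPE('k::field) (clique_complex E S) 3 (Q * (card S * (Q * (2 * e)) + card S * (Q * K)))"
proof (rule betti_le_mono[OF betti_le_bad])
  have L: "leaders \<subseteq> S" by (auto simp: leaders_def)
  have "(\<Sum>v\<in>S. card (bad v)) = (\<Sum>v\<in>S - leaders. card (bad v)) + (\<Sum>v\<in>leaders. card (bad v))"
    by (rule sum.subset_diff[OF L fin])
  also have "\<dots> \<le> (\<Sum>v\<in>S - leaders. Q * (2 * e)) + card S * (Q * K)"
    by (intro add_mono sum_mono card_bad_le sum_bad_leaders_le)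
  also have "(\<Sum>v\<in>S - leaders. Q * (2 * e)) \<le> card S * (Q * (2 * e))"
    using fin by (simp add: card_mono)
  finally show "(\<Sum>v\<in>S. Q * card (bad v)) \<le> Q * (card S * (Q * (2 * e)) + card S * (Q * K))"
    by (simp flip: sum_distrib_left)
qed

end

section \<open>Vietoris--Rips complexes\<close>

lemma vietoris_rips_eq_clique_complex:
  assumes "finite S"
  shows "vietoris_rips S = clique_complex (\<lambda>x y. dist x y \<le> 1) S"
proof -
  have "diameter \<sigma> \<le> 1 \<longleftrightarrow> (\<forall>x\<in>\<sigma>. \<forall>y\<in>\<sigma>. dist x y \<le> 1)" if "\<sigma> \<subseteq> S" for \<sigma>
  proof
    have "bounded \<sigma>" using that assms finite_subset finite_imp_bounded by metis
    then show "\<forall>x\<in>\<sigma>. \<forall>y\<in>\<sigma>. dist x y \<le> 1" if "diameter \<sigma> \<le> 1"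
      using that diameter_bounded_bound by (meson order_trans)
    show "diameter \<sigma> \<le> 1" if "\<forall>x\<in>\<sigma>. \<forall>y\<in>\<sigma>. dist x y \<le> 1"
      \<comment> \<open>The empty set has diameter 0 by convention, so the empty face belongs to
        both complexes.\<close>
      using that by (cases "\<sigma> = {}") (auto simp: diameter_def intro!: cSUP_least)
  qed
  then show ?thesis unfolding vietoris_rips_def clique_complex_def by blast
qed

theorem theorem4p4:
  fixes \<delta> :: real
  assumes "\<delta> > 0"
  shows "\<forall>\<^sub>F n in sequentially.
           real (max_betti_rips TYPE('k::field) TYPE('d::finite) 2 n) < \<delta> * (real n)\<^sup>2"
proof -
  obtain cell :: "real ^ 'd \<Rightarrow> int ^ 'd" and Q :: nat where
    cell: "\<And>x y. cell x = cell y \<Longrightarrow> dist x y \<le> 1"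
    and Q: "\<And>v. finite (cell ` {x. dist v x \<le> 1}) \<and> card (cell ` {x. dist v x \<le> 1}) \<le> Q"
    by (rule unit_cells) blast
  \<comment> \<open>Chosen so that the quadratic part of \<open>bound n\<close> is at most half of
    the target; the added 1 keeps the denominator positive when \<open>Q\<close> is 0.\<close>
  define \<eta> where "\<eta> = \<delta> / (4 * ((real Q)\<^sup>2 + 1))"
  have q: "0 < (real Q)\<^sup>2 + 1" by (simp add: add_nonneg_pos)
  have eta: "0 < \<eta>" using assms q unfolding \<eta>_def by simp
  obtain K :: nat where
    K: "\<And>S :: (real ^ 'd) set. finite S \<Longrightarrow>
       \<exists>cl :: real ^ 'd \<Rightarrow> (real ^ 'd) set. card (cl ` S) \<le> K \<and>
         (\<forall>u\<in>S. \<forall>v\<in>S. cl u = cl v \<longrightarrow>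
            card {x \<in> S. dist u x \<le> 1 \<and> \<not> dist v x \<le> 1} \<le> \<eta> * card S)"
    by (rule neighbourhood_classes[OF eta]) blast
  define bound where "bound n = (real Q)\<^sup>2 * real n * (2 * \<eta> * real n + real K)" for n :: nat
  have le: "reduced_betti TYPE('k) 2 (vietoris_rips S) \<le> bound n"
    if S: "finite S" "card S \<le> n" for S :: "(real ^ 'd) set" and n
  proof -
    obtain cl :: "real ^ 'd \<Rightarrow> (real ^ 'd) set" where cl: "card (cl ` S) \<le> K"
      and near: "\<forall>u\<in>S. \<forall>v\<in>S. cl u = cl v \<longrightarrow>
        card {x \<in> S. dist u x \<le> 1 \<and> \<not> dist v x \<le> 1} \<le> \<eta> * card S"
      using K[OF S(1)] by (elim exE conjE) (rule that)
    obtain idx :: "real ^ 'd \<Rightarrow> nat" where idx: "inj_on idx S"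
      using finite_imp_inj_to_nat_seg[OF S(1)] by blast
    \<comment> \<open>The locale wants a natural number; rounding down is harmless because
      cardinalities are integers.\<close>
    define e where "e = nat \<lfloor>\<eta> * card S\<rfloor>"
    have e: "real e \<le> \<eta> * card S" using eta unfolding e_def by simp
    interpret cell_graph "\<lambda>x y :: real ^ 'd. dist x y \<le> 1" S cell cl Q K e idx
    proof
      show "card (cell ` {x \<in> S. dist v x \<le> 1}) \<le> Q" for v
        using card_mono[of "cell ` {x. dist v x \<le> 1}" "cell ` {x \<in> S. dist v x \<le> 1}"] Q[of v]
        by (auto intro: le_trans)
      show "card {x \<in> S. dist u x \<le> 1 \<and> \<not> dist v x \<le> 1} \<le> e"
        if "u \<in> S" "v \<in> S" "cl u = cl v" for u v
        using near that unfolding e_def by (auto intro!: le_nat_floor)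
    qed (use cell cl idx S(1) in \<open>auto simp: dist_commute\<close>)
    have "betti_le TYPE('k) (vietoris_rips S) (Suc 2)
        (Q * (card S * (Q * (2 * e)) + card S * (Q * K)))"
      using betti_le_cell_graph unfolding vietoris_rips_eq_clique_complex[OF S(1)]
      by (simp add: numeral_3_eq_3 numeral_2_eq_2)
    then have "reduced_betti TYPE('k) 2 (vietoris_rips S)
        \<le> Q * (card S * (Q * (2 * e)) + card S * (Q * K))"
      unfolding vietoris_rips_eq_clique_complex[OF S(1)] by (rule reduced_betti_le[OF S(1)])
    then have "real (reduced_betti TYPE('k) 2 (vietoris_rips S))
        \<le> real (Q * (card S * (Q * (2 * e)) + card S * (Q * K)))" by (simp only: of_nat_le_iff)
    also have "\<dots> = (real Q)\<^sup>2 * card S * (2 * real e + K)"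
      by (simp add: power2_eq_square algebra_simps)
    also have "\<dots> \<le> bound n"
    proof -
      have "\<eta> * card S \<le> \<eta> * n" using S(2) eta by (intro mult_left_mono) auto
      then have "2 * real e + K \<le> 2 * \<eta> * real n + K" using e by linarith
      moreover have "(real Q)\<^sup>2 * card S \<le> (real Q)\<^sup>2 * n" using S(2) by (intro mult_left_mono) auto
      ultimately show ?thesis unfolding bound_def using S(2) by (intro mult_mono) auto
    qed
    finally show ?thesis .
  qed
  have max: "real (max_betti_rips TYPE('k) TYPE('d) 2 n) \<le> bound n" for n
  proof -
    \<comment> \<open>\<open>Max\<close> is meaningful only for a finite nonempty set: the bound
      just proved gives finiteness, and the empty point set gives an element.\<close>
    let ?M = "{reduced_betti TYPE('k) 2 (vietoris_rips S) | S :: (real ^ 'd) set. finite S \<and> card S \<le> n}"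
    have "?M \<subseteq> {..nat \<lfloor>bound n\<rfloor>}" using le by (auto intro!: le_nat_floor)
    then have "finite ?M" by (rule finite_subset) simp
    moreover have "reduced_betti TYPE('k) 2 (vietoris_rips ({} :: (real ^ 'd) set)) \<in> ?M"
      by (rule CollectI, rule exI[of _ "{}"]) simp
    ultimately have "Max ?M \<in> ?M" by (intro Max_in) auto
    then show ?thesis unfolding max_betti_rips_def using le by auto
  qed
  \<comment> \<open>From \<open>N\<close> on, the linear term of \<open>bound n\<close> is strictly
    below the other half of the target.\<close>
  obtain N :: nat where N: "2 * (real Q)\<^sup>2 * real K / \<delta> < real N" using reals_Archimedean2 by blast
  have "bound n < \<delta> * (real n)\<^sup>2" if "n \<ge> N" "n \<ge> 1" for n
  proof -
    have "2 * (real Q)\<^sup>2 * real K / \<delta> < real n" using N that(1) by linarith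
    then have "2 * (real Q)\<^sup>2 * real K < \<delta> * real n" using assms by (simp add: field_simps)
    then have 1: "(real Q)\<^sup>2 * real K * real n < \<delta> / 2 * (real n)\<^sup>2"
      using that(2) by (simp add: power2_eq_square)
    have "(real Q)\<^sup>2 * \<eta> \<le> ((real Q)\<^sup>2 + 1) * \<eta>" using eta by (intro mult_right_mono) auto
    also have "\<dots> = \<delta> / 4" using q unfolding \<eta>_def by (simp add: field_simps)
    finally have "(real Q)\<^sup>2 * \<eta> * (2 * (real n)\<^sup>2) \<le> \<delta> / 4 * (2 * (real n)\<^sup>2)"
      by (rule mult_right_mono) simp
    then show ?thesis using 1 unfolding bound_def by (simp add: power2_eq_square algebra_simps)
  qed
  then have "\<forall>n\<ge>max N 1. real (max_betti_rips TYPE('k) TYPE('d) 2 n) < \<delta> * (real n)\<^sup>2"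
    using max by (meson le_less_trans max.boundedE)
  then show ?thesis unfolding eventually_sequentially by blast
qed

end
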